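(* Let $R=S/I$ where $S=k[x_1,\ldots,x_d]$ is a polynomial ring over an $F$-finite field $k$ of prime characteristic $p$ and $I$ is a homogeneous ideal of $S$. Let $J$ be an ideal of $R$. Then $$\left(C_R(J)\right)^h=C_{R[t]}(J^h)\quad\text{and}\quad C_R(J)=\delta\left(C_{R[t]}(J^h)\right).$$
   Context: For a ring $A$ of characteristic $p$, $F_*^eA$ denotes $A$ viewed as an $A$-module via the $e$-th iterate of Frobenius: $a\,F_*^es=F_*^e(a^{p^e}s)$; $A$ is $F$-finite if $F_*A$ is a finitely generated $A$-module. The Cartier core of an ideal $\mathfrak b$ of $A$ is $C_A(\mathfrak b)=\{a\in A:\phi(F_*^ea)\in\mathfrak b\text{ for all }e>0\text{ and all }\phi\in\operatorname{Hom}_A(F_*^eA,A)\}$. $R$ is $\mathbb N$-graded by the (standard) grading of $S$, and $t$ is a new variable of degree 1. For $f\in R$, $f^h\in R[t]$ is its minimal homogenization, $f^h=t^{\deg f}f\left(\frac{x_1}{t},\ldots,\frac{x_d}{t}\right)$; i.e. if $f=\sum_{i\le n}f_i$ with $f_i$ homogeneous of degree $i$ and $f_n\ne0$, then $f^h=\sum_i f_it^{n-i}$. For an ideal $J$ of $R$, $J^h=\langle f^h: f\in J\rangle\subseteq R[t]$. The dehomogenization map $\delta:R[t]\to R$ is the $R$-algebra map with $\delta(t)=1$. *)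

theory Defs
  imports
    "HOL-Algebra.Algebra"
    "HOL-Algebra.Algebraic_Closure_Type"
    "HOL-Library.Poly_Mapping"
begin

section \<open>Frobenius pushforwards and the Cartier core\<close>

definition self_module :: "('a, 'm) ring_scheme \<Rightarrow> ('a, 'a) module" where
  "self_module A =
     \<lparr>carrier = carrier A, monoid.mult = monoid.mult A, one = monoid.one A,
      ring.zero = ring.zero A, add = ring.add A,
      module.smult = (\<lambda>a s. a \<otimes>\<^bsub>A\<^esub> s)\<rparr>"

text \<open>\<open>frob_module p e A\<close> is \<open>F\<^sub>*\<^sup>e A\<close> for a ring \<open>A\<close> of characteristic \<open>p\<close>. The characteristic
  is an explicit parameter, so that the zero ring (in which \<open>p = 0\<close> holds as well) is covered.
  The ring multiplication carried by the record plays no role.\<close>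

definition frob_module :: "nat \<Rightarrow> nat \<Rightarrow> ('a, 'm) ring_scheme \<Rightarrow> ('a, 'a) module" where
  "frob_module p e A =
     \<lparr>carrier = carrier A, monoid.mult = monoid.mult A, one = monoid.one A,
      ring.zero = ring.zero A, add = ring.add A,
      module.smult = (\<lambda>a s. (a [^]\<^bsub>A\<^esub> (p ^ e)) \<otimes>\<^bsub>A\<^esub> s)\<rparr>"

definition module_homs ::
  "('a, 'm) ring_scheme \<Rightarrow> ('a, 'b, 'n) module_scheme \<Rightarrow> ('a, 'c, 'l) module_scheme
     \<Rightarrow> ('b \<Rightarrow> 'c) set" where
  "module_homs A M N =
     {\<phi> \<in> carrier M \<rightarrow> carrier N.
        (\<forall>x\<in>carrier M. \<forall>y\<in>carrier M. \<phi> (x \<oplus>\<^bsub>M\<^esub> y) = \<phi> x \<oplus>\<^bsub>N\<^esub> \<phi> y) \<and>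
        (\<forall>a\<in>carrier A. \<forall>x\<in>carrier M. \<phi> (a \<odot>\<^bsub>M\<^esub> x) = a \<odot>\<^bsub>N\<^esub> \<phi> x)}"

definition finitely_generated_module ::
  "('a, 'm) ring_scheme \<Rightarrow> ('a, 'b, 'n) module_scheme \<Rightarrow> bool" where
  "finitely_generated_module A M \<longleftrightarrow>
     (\<exists>B. finite B \<and> B \<subseteq> carrier M \<and>
        (\<forall>x\<in>carrier M. \<exists>c \<in> B \<rightarrow> carrier A. x = (\<Oplus>\<^bsub>M\<^esub>b\<in>B. c b \<odot>\<^bsub>M\<^esub> b)))"

definition F_finite :: "nat \<Rightarrow> ('a, 'm) ring_scheme \<Rightarrow> bool" where
  "F_finite p A \<longleftrightarrow> finitely_generated_module A (frob_module p 1 A)"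

definition cartier_core :: "nat \<Rightarrow> ('a, 'm) ring_scheme \<Rightarrow> 'a set \<Rightarrow> 'a set" where
  "cartier_core p A \<bb> =
     {a \<in> carrier A. \<forall>e>0. \<forall>\<phi> \<in> module_homs A (frob_module p e A) (self_module A). \<phi> a \<in> \<bb>}"


section \<open>Graded rings\<close>

text \<open>A grading of a ring \<open>A\<close> is given by its family \<open>G\<close> of graded pieces. The definite
  description is meaningful whenever \<open>A\<close> is the direct sum of the \<open>G i\<close>.\<close>

definition homogeneous_components ::
  "('a, 'm) ring_scheme \<Rightarrow> (nat \<Rightarrow> 'a set) \<Rightarrow> 'a \<Rightarrow> (nat \<Rightarrow> 'a)" where
  "homogeneous_components A G f =
     (THE c. (\<forall>i. c i \<in> G i) \<and> finite {i. c i \<noteq> \<zero>\<^bsub>A\<^esub>} \<and>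
             f = (\<Oplus>\<^bsub>A\<^esub>i\<in>{i. c i \<noteq> \<zero>\<^bsub>A\<^esub>}. c i))"

definition graded_degree :: "('a, 'm) ring_scheme \<Rightarrow> (nat \<Rightarrow> 'a set) \<Rightarrow> 'a \<Rightarrow> nat" where
  "graded_degree A G f = Max {i. homogeneous_components A G f i \<noteq> \<zero>\<^bsub>A\<^esub>}"

definition homogeneous_ideal ::
  "('a, 'm) ring_scheme \<Rightarrow> (nat \<Rightarrow> 'a set) \<Rightarrow> 'a set \<Rightarrow> bool" where
  "homogeneous_ideal A G I \<longleftrightarrow> ideal I A \<and> I = Idl\<^bsub>A\<^esub> (I \<inter> (\<Union>i. G i))"

definition quotient_grading ::
  "('a, 'm) ring_scheme \<Rightarrow> 'a set \<Rightarrow> (nat \<Rightarrow> 'a set) \<Rightarrow> (nat \<Rightarrow> 'a set set)" where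
  "quotient_grading A I G i = (\<lambda>s. I +>\<^bsub>A\<^esub> s) ` G i"


section \<open>Homogenization and dehomogenization\<close>

text \<open>\<open>R[t]\<close> is \<open>UP R\<close>, so the indeterminate \<open>t\<close> is anonymous and \<open>f\<^sub>i t\<^sup>n\<^sup>-\<^sup>i\<close> is
  \<open>monom (UP R) f\<^sub>i (n - i)\<close>. The degree of \<open>0\<close> is unspecified, but the homogenization of \<open>0\<close> is
  still \<open>0\<close>, because all its components vanish.\<close>

definition homogenization ::
  "('a, 'm) ring_scheme \<Rightarrow> (nat \<Rightarrow> 'a set) \<Rightarrow> 'a \<Rightarrow> (nat \<Rightarrow> 'a)" where
  "homogenization A G f =
     (let n = graded_degree A G f in
      \<Oplus>\<^bsub>UP A\<^esub>i\<in>{..n}. up_ring.monom (UP A) (homogeneous_components A G f i) (n - i))"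

definition homogenization_ideal ::
  "('a, 'm) ring_scheme \<Rightarrow> (nat \<Rightarrow> 'a set) \<Rightarrow> 'a set \<Rightarrow> (nat \<Rightarrow> 'a) set" where
  "homogenization_ideal A G J = Idl\<^bsub>UP A\<^esub> (homogenization A G ` J)"

definition dehomogenization :: "('a, 'm) ring_scheme \<Rightarrow> (nat \<Rightarrow> 'a) \<Rightarrow> 'a" where
  "dehomogenization A = UnivPoly.eval A A id \<one>\<^bsub>A\<^esub>"


section \<open>The polynomial ring in \<open>d\<close> variables and its standard grading\<close>

text \<open>A monomial is a finitely supported exponent vector \<open>nat \<Rightarrow>\<^sub>0 nat\<close>, and
  \<open>(nat \<Rightarrow>\<^sub>0 nat) \<Rightarrow>\<^sub>0 'k\<close> (with the convolution product) is the polynomial ring over \<open>'k\<close> in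
  countably many variables. The carrier restricts the variables to \<open>x\<^sub>1, \<dots>, x\<^sub>d\<close>.\<close>

definition mpoly_ring :: "nat \<Rightarrow> ((nat \<Rightarrow>\<^sub>0 nat) \<Rightarrow>\<^sub>0 'k::field) ring" where
  "mpoly_ring d = ring_of_type_algebra
     \<lparr>carrier := {f. \<forall>m \<in> Poly_Mapping.keys f. Poly_Mapping.keys m \<subseteq> {1..d}}\<rparr>"

definition standard_grading :: "nat \<Rightarrow> nat \<Rightarrow> ((nat \<Rightarrow>\<^sub>0 nat) \<Rightarrow>\<^sub>0 'k::field) set" where
  "standard_grading d i =
     {f \<in> carrier (mpoly_ring d). \<forall>m \<in> Poly_Mapping.keys f.
        (\<Sum>v\<in>Poly_Mapping.keys m. Poly_Mapping.lookup m v) = i}"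

end

theory Submission
  imports Defs
begin

text \<open>For a homogeneous element \<open>g\<close> of \<open>R[t]\<close> (total degree) and an ideal \<open>J\<close> of \<open>R\<close>, the element
  \<open>g\<close> is a power of \<open>t\<close> times \<open>(\<delta> g)\<^sup>h\<close>; hence \<open>g \<in> J\<^sup>h\<close> if and only if \<open>\<delta> g \<in> J\<close>, and
  \<open>J\<^sup>h\<close> is determined by \<open>J\<close> degree by degree. Both claims therefore follow once three facts
  about the core \<open>C = C(J\<^sup>h)\<close> in \<open>R[t]\<close> are known: \<open>C\<close> is a homogeneous ideal, \<open>\<delta>\<close> maps \<open>C\<close>
  into the core of \<open>J\<close>, and \<open>f\<^sup>h \<in> C\<close> for every \<open>f\<close> in the core of \<open>J\<close>. Each of them is a
  statement that certain additive maps \<open>\<phi>\<close> with \<open>\<phi> (a\<^sup>q x) = a \<phi> x\<close>, where \<open>q = p\<^sup>e\<close>, exist;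
  these are the elements of \<open>Hom(F\<^sub>*\<^sup>e A, A)\<close>.

  \<^item> Homogeneity (\<open>truncate_frob_hom\<close>): keeping, for \<open>x\<close> of degree \<open>i\<close>, only the component of
    \<open>\<phi> x\<close> whose degree is \<open>m + (i - n) / q\<close> gives again such a map. It has the fractional
    degree \<open>m - n / q\<close>, so the degree \<open>m\<close> part of its value at \<open>a\<close> only sees the degree \<open>n\<close>
    part of \<open>a\<close>. As \<open>J\<^sup>h\<close> is homogeneous, all components of an element of \<open>C\<close> lie in \<open>C\<close>.

  \<^item> From \<open>R\<close> to \<open>R[t]\<close> (\<open>extend_frob_hom\<close>): a map \<open>\<psi>\<close> on \<open>R\<close> extends to \<open>R[t]\<close> by
    \<open>s t\<^sup>m \<mapsto> \<psi> s t\<^bsup>m div q\<^esup>\<close>, and this extension commutes with \<open>\<delta>\<close>. Hence \<open>\<delta> C\<close> lies in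
    the core of \<open>J\<close>.

  \<^item> From \<open>R[t]\<close> to \<open>R\<close> (\<open>descend_frob_hom\<close>): given \<open>\<phi>\<close> on \<open>R[t]\<close> and a degree \<open>n\<close>, there is
    a map \<open>\<psi>\<close> on \<open>R\<close> with \<open>\<psi> (\<delta> a) = \<delta> (\<phi> a)\<close> for all \<open>a\<close> of degree \<open>n\<close>. The obvious choice
    \<open>s \<mapsto> \<delta> (\<phi> (s t\<^bsup>n - i\<^esup>))\<close> for \<open>s\<close> of degree \<open>i\<close> has a negative exponent as soon as
    \<open>i > n\<close>; multiplying the argument by \<open>(t\<^sup>i)\<^sup>q\<close> multiplies the value by \<open>t\<^sup>i\<close>, which
    \<open>\<delta>\<close> does not see, so the exponent \<open>n + (q - 1) i\<close> serves instead. Applied to a map that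
    is truncated to a single degree, this shows that every component of \<open>\<phi> (f\<^sup>h)\<close> lies in
    \<open>J\<^sup>h\<close> when \<open>f\<close> is in the core of \<open>J\<close>.

  All three maps are first prescribed on homogeneous elements and then assembled by additivity
  (\<open>glue_in_frob_homs\<close>). That step is where characteristic \<open>p\<close> enters: the rule
  \<open>\<phi> (a\<^sup>q x) = a \<phi> x\<close> passes from homogeneous \<open>a\<close> to sums because \<open>a \<mapsto> a\<^sup>q\<close> is additive.\<close>

section \<open>Additivity of the Frobenius map\<close>

context cring
begin

lemma binomial_formula:
  assumes [simp]: "x \<in> carrier R" "y \<in> carrier R"
  shows "(x \<oplus> y) [^] n = (\<Oplus>k\<in>{..n}. [(n choose k)] \<cdot>\<^bsub>R\<^esub> (x [^] k \<otimes> y [^] (n - k)))"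
proof (induction n)
  case 0
  show ?case by simp
next
  case (Suc n)
  define g where "g m k = [(m choose k)] \<cdot>\<^bsub>R\<^esub> (x [^] k \<otimes> y [^] (m - k))" for m k :: nat
  have [simp]: "g m k \<in> carrier R" for m k
    by (simp add: g_def)
  have rec: "g (Suc n) (Suc k) = x \<otimes> g n k \<oplus> y \<otimes> g n (Suc k)" if "k \<le> n" for k
  proof -
    have "y \<otimes> g n (Suc k) = [(n choose Suc k)] \<cdot>\<^bsub>R\<^esub> (x [^] Suc k \<otimes> y [^] (n - k))"
    proof (cases "k < n")
      case True
      hence "n - k = Suc (n - Suc k)" by simp
      thus ?thesis
        by (simp add: g_def add_pow_rdistr m_ac del: diff_Suc_Suc)
    next
      case False
      with that have "k = n" by simp
      thus ?thesis by (simp add: g_def binomial_eq_0)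
    qed
    moreover have "x \<otimes> g n k = [(n choose k)] \<cdot>\<^bsub>R\<^esub> (x [^] Suc k \<otimes> y [^] (n - k))"
      by (simp add: g_def add_pow_rdistr m_ac)
    ultimately show ?thesis
      by (simp add: g_def add.nat_pow_mult)
  qed
  have "(\<Oplus>k\<in>{..Suc n}. g (Suc n) k) = (\<Oplus>k\<in>{..n}. g (Suc n) (Suc k)) \<oplus> g (Suc n) 0"
    by (subst finsum_Suc2) auto
  also have "(\<Oplus>k\<in>{..n}. g (Suc n) (Suc k)) = (\<Oplus>k\<in>{..n}. x \<otimes> g n k \<oplus> y \<otimes> g n (Suc k))"
    by (intro finsum_cong') (auto simp: rec)
  also have "\<dots> = x \<otimes> (\<Oplus>k\<in>{..n}. g n k) \<oplus> y \<otimes> (\<Oplus>k\<in>{..n}. g n (Suc k))"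
    by (simp add: finsum_addf finsum_rdistr Pi_def)
  also have "g (Suc n) 0 = y \<otimes> g n 0"
    by (simp add: g_def m_ac)
  also have "x \<otimes> (\<Oplus>k\<in>{..n}. g n k) \<oplus> y \<otimes> (\<Oplus>k\<in>{..n}. g n (Suc k)) \<oplus> y \<otimes> g n 0 =
      x \<otimes> (\<Oplus>k\<in>{..n}. g n k) \<oplus> y \<otimes> (\<Oplus>k\<in>{..Suc n}. g n k)"
    by (subst finsum_Suc2) (auto simp: r_distr a_assoc)
  also have "(\<Oplus>k\<in>{..Suc n}. g n k) = (\<Oplus>k\<in>{..n}. g n k)"
    by (simp add: Pi_def) (simp add: g_def binomial_eq_0)
  also have "(\<Oplus>k\<in>{..n}. g n k) = (x \<oplus> y) [^] n"
    using Suc.IH by (simp add: g_def)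
  also have "x \<otimes> (x \<oplus> y) [^] n \<oplus> y \<otimes> (x \<oplus> y) [^] n = (x \<oplus> y) [^] Suc n"
    by (simp add: m_comm[of _ "x \<oplus> y"] l_distr)
  finally show ?case
    unfolding g_def by (rule sym)
qed

text \<open>The binomial coefficients strictly between the two ends are divisible by \<open>p\<close>. The ring may
  be zero, so the assumption is \<open>p = 0\<close> in the ring rather than that the characteristic is \<open>p\<close>.\<close>
lemma prime_char_pow_add:
  fixes p :: nat
  assumes p: "Factorial_Ring.prime p" and char: "[p] \<cdot>\<^bsub>R\<^esub> \<one> = \<zero>"
    and [simp]: "x \<in> carrier R" "y \<in> carrier R"
  shows "(x \<oplus> y) [^] p = x [^] p \<oplus> y [^] p"
proof -
  have kill: "[(p choose k)] \<cdot>\<^bsub>R\<^esub> z = \<zero>" if "0 < k" "k < p" "z \<in> carrier R" for k z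
  proof -
    have "p dvd (p choose k)"
      using that p by (intro dvd_choose_prime) auto
    then obtain m where m: "p choose k = p * m" ..
    have "[p] \<cdot>\<^bsub>R\<^esub> z = [p] \<cdot>\<^bsub>R\<^esub> \<one> \<otimes> z"
      using that by (subst add_pow_ldistr) auto
    hence "[p] \<cdot>\<^bsub>R\<^esub> z = \<zero>"
      using char that by simp
    moreover have "[(p choose k)] \<cdot>\<^bsub>R\<^esub> z = [m] \<cdot>\<^bsub>R\<^esub> ([p] \<cdot>\<^bsub>R\<^esub> z)"
      using that by (simp add: m add.nat_pow_pow mult.commute)
    ultimately show ?thesis by simp
  qed
  define g where "g k = [(p choose k)] \<cdot>\<^bsub>R\<^esub> (x [^] k \<otimes> y [^] (p - k))" for k :: nat
  have [simp]: "g k \<in> carrier R" for k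
    by (simp add: g_def)
  have "p > 0" using p by (simp add: prime_gt_0_nat)
  have "(x \<oplus> y) [^] p = (\<Oplus>k\<in>{..p}. g k)"
    unfolding g_def by (simp add: binomial_formula)
  also have "\<dots> = (\<Oplus>k\<in>{0, p}. g k)"
    by (rule add.finprod_mono_neutral_cong_right)
       (auto simp: kill g_def)
  also have "\<dots> = g 0 \<oplus> g p"
    using \<open>p > 0\<close> by (simp add: Pi_def)
  also have "\<dots> = x [^] p \<oplus> y [^] p"
    by (simp add: g_def a_comm)
  finally show ?thesis .
qed

lemma prime_char_pow_pow_add:
  fixes p :: nat
  assumes p: "Factorial_Ring.prime p" and char: "[p] \<cdot>\<^bsub>R\<^esub> \<one> = \<zero>"
    and [simp]: "x \<in> carrier R" "y \<in> carrier R"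
  shows "(x \<oplus> y) [^] (p ^ e) = x [^] (p ^ e) \<oplus> y [^] (p ^ e)"
proof (induction e)
  case (Suc e)
  have "z [^] (p ^ Suc e) = (z [^] (p ^ e)) [^] p" if "z \<in> carrier R" for z
    using that by (simp add: nat_pow_pow mult.commute)
  thus ?case
    using Suc.IH by (simp add: prime_char_pow_add[OF p char])
qed simp

end

lemma (in ring_hom_cring) char_eq_zero_image:
  fixes n :: nat
  assumes "[n] \<cdot>\<^bsub>R\<^esub> \<one>\<^bsub>R\<^esub> = \<zero>\<^bsub>R\<^esub>"
  shows "[n] \<cdot>\<^bsub>S\<^esub> \<one>\<^bsub>S\<^esub> = \<zero>\<^bsub>S\<^esub>"
proof -
  have "h ([n] \<cdot>\<^bsub>R\<^esub> \<one>\<^bsub>R\<^esub>) = [n] \<cdot>\<^bsub>S\<^esub> \<one>\<^bsub>S\<^esub>"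
    by (induction n) auto
  thus ?thesis
    using assms by simp
qed

section \<open>The maps that define the Cartier core\<close>

text \<open>These are the homomorphisms from \<open>F\<^sub>*\<^sup>e A\<close> to \<open>A\<close> when \<open>q = p\<^sup>e\<close>, freed from the module records.\<close>
definition frob_homs :: "nat \<Rightarrow> ('a, 'm) ring_scheme \<Rightarrow> ('a \<Rightarrow> 'a) set" where
  "frob_homs q A =
     {\<phi> \<in> carrier A \<rightarrow> carrier A.
        (\<forall>x\<in>carrier A. \<forall>y\<in>carrier A. \<phi> (x \<oplus>\<^bsub>A\<^esub> y) = \<phi> x \<oplus>\<^bsub>A\<^esub> \<phi> y) \<and>
        (\<forall>a\<in>carrier A. \<forall>x\<in>carrier A. \<phi> (a [^]\<^bsub>A\<^esub> q \<otimes>\<^bsub>A\<^esub> x) = a \<otimes>\<^bsub>A\<^esub> \<phi> x)}"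

lemma module_homs_frob_eq_frob_homs:
  "module_homs A (frob_module p e A) (self_module A) = frob_homs (p ^ e) A"
  by (simp add: module_homs_def frob_module_def self_module_def frob_homs_def)

lemma cartier_core_alt:
  "cartier_core p A \<bb> = {a \<in> carrier A. \<forall>e>0. \<forall>\<phi>\<in>frob_homs (p ^ e) A. \<phi> a \<in> \<bb>}"
  by (simp add: cartier_core_def module_homs_frob_eq_frob_homs)

lemma frob_homsD:
  assumes "\<phi> \<in> frob_homs q A"
  shows "x \<in> carrier A \<Longrightarrow> \<phi> x \<in> carrier A"
    and "x \<in> carrier A \<Longrightarrow> y \<in> carrier A \<Longrightarrow> \<phi> (x \<oplus>\<^bsub>A\<^esub> y) = \<phi> x \<oplus>\<^bsub>A\<^esub> \<phi> y"
    and "a \<in> carrier A \<Longrightarrow> x \<in> carrier A \<Longrightarrow> \<phi> (a [^]\<^bsub>A\<^esub> q \<otimes>\<^bsub>A\<^esub> x) = a \<otimes>\<^bsub>A\<^esub> \<phi> x"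
  using assms by (auto simp: frob_homs_def)

lemma additive_zero:
  assumes "abelian_group A" "abelian_group B" "f (\<zero>\<^bsub>A\<^esub>) \<in> carrier B"
    and "\<And>x y. x \<in> carrier A \<Longrightarrow> y \<in> carrier A \<Longrightarrow> f (x \<oplus>\<^bsub>A\<^esub> y) = f x \<oplus>\<^bsub>B\<^esub> f y"
  shows "f (\<zero>\<^bsub>A\<^esub>) = \<zero>\<^bsub>B\<^esub>"
proof -
  interpret A: abelian_group A by fact
  interpret B: abelian_group B by fact
  have "f \<zero>\<^bsub>A\<^esub> \<oplus>\<^bsub>B\<^esub> f \<zero>\<^bsub>A\<^esub> = f \<zero>\<^bsub>A\<^esub>"
    using assms(4)[of "\<zero>\<^bsub>A\<^esub>" "\<zero>\<^bsub>A\<^esub>"] by simp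
  thus ?thesis
    using assms(3) by (simp add: B.add.l_cancel_one)
qed

lemma additive_finsum:
  assumes "abelian_group A" "abelian_group B" "f \<in> carrier A \<rightarrow> carrier B"
    and "\<And>x y. x \<in> carrier A \<Longrightarrow> y \<in> carrier A \<Longrightarrow> f (x \<oplus>\<^bsub>A\<^esub> y) = f x \<oplus>\<^bsub>B\<^esub> f y"
    and "g \<in> F \<rightarrow> carrier A"
  shows "f (\<Oplus>\<^bsub>A\<^esub>i\<in>F. g i) = (\<Oplus>\<^bsub>B\<^esub>i\<in>F. f (g i))"
proof -
  interpret A: abelian_group A by fact
  interpret B: abelian_group B by fact
  have "f (\<zero>\<^bsub>A\<^esub>) = \<zero>\<^bsub>B\<^esub>"
    using assms by (intro additive_zero) auto
  thus ?thesis
    using assms(3-5) by (induction F rule: infinite_finite_induct) (auto simp: Pi_def)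
qed

lemma frob_homs_zero:
  assumes "cring A" "\<phi> \<in> frob_homs q A"
  shows "\<phi> \<zero>\<^bsub>A\<^esub> = \<zero>\<^bsub>A\<^esub>"
proof -
  interpret cring A by fact
  show ?thesis
    using assms(2) by (intro additive_zero) (auto simp: frob_homs_def intro: abelian_group_axioms)
qed

text \<open>This is why a Cartier core is an ideal: it is stable under multiplication by \<open>b\<close>.\<close>
lemma frob_homs_precompose_mult:
  assumes "cring A" "\<phi> \<in> frob_homs q A" "b \<in> carrier A"
  shows "(\<lambda>x. \<phi> (b \<otimes>\<^bsub>A\<^esub> x)) \<in> frob_homs q A"
proof -
  interpret cring A by fact
  have "\<phi> (b \<otimes>\<^bsub>A\<^esub> (a [^]\<^bsub>A\<^esub> q \<otimes>\<^bsub>A\<^esub> x)) = a \<otimes>\<^bsub>A\<^esub> \<phi> (b \<otimes>\<^bsub>A\<^esub> x)"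
    if "a \<in> carrier A" "x \<in> carrier A" for a x
    using that assms(3) frob_homsD(3)[OF assms(2), of a "b \<otimes>\<^bsub>A\<^esub> x"]
    by (simp add: m_lcomm[of b])
  thus ?thesis
    using assms(2,3) by (auto simp: frob_homs_def r_distr Pi_def)
qed

lemma cartier_core_ideal:
  assumes "cring A" "ideal P A"
  shows "ideal (cartier_core p A P) A"
proof -
  interpret cring A by fact
  interpret P: ideal P A by fact
  have zero: "\<zero>\<^bsub>A\<^esub> \<in> cartier_core p A P"
  proof -
    have "\<phi> \<zero>\<^bsub>A\<^esub> \<in> P" if "\<phi> \<in> frob_homs q A" for \<phi> q
      using frob_homs_zero[OF assms(1) that] additive_subgroup.zero_closed[OF P.is_additive_subgroup]
      by simp
    thus ?thesis by (auto simp: cartier_core_alt)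
  qed
  have mult: "b \<otimes>\<^bsub>A\<^esub> a \<in> cartier_core p A P"
    if "a \<in> cartier_core p A P" "b \<in> carrier A" for a b
  proof -
    have "\<phi> (b \<otimes>\<^bsub>A\<^esub> a) \<in> P" if "e > 0" "\<phi> \<in> frob_homs (p ^ e) A" for e \<phi>
    proof -
      have "\<forall>\<phi>\<in>frob_homs (p ^ e) A. \<phi> a \<in> P"
        using \<open>a \<in> cartier_core p A P\<close> \<open>e > 0\<close> by (simp add: cartier_core_alt)
      from bspec[OF this frob_homs_precompose_mult[OF assms(1) that(2) \<open>b \<in> carrier A\<close>]]
      show ?thesis .
    qed
    thus ?thesis
      using that by (auto simp: cartier_core_alt)
  qed
  have carr: "a \<in> carrier A" if "a \<in> cartier_core p A P" for a
    using that by (simp add: cartier_core_alt)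
  have add: "a \<oplus>\<^bsub>A\<^esub> b \<in> cartier_core p A P"
    if "a \<in> cartier_core p A P" "b \<in> cartier_core p A P" for a b
    using that by (auto simp: cartier_core_alt frob_homsD(2))
  have neg: "\<ominus>\<^bsub>A\<^esub> a \<in> cartier_core p A P" if "a \<in> cartier_core p A P" for a
    using mult[OF that, of "\<ominus>\<^bsub>A\<^esub> \<one>\<^bsub>A\<^esub>"] carr[OF that] by (simp add: l_minus)
  have "additive_subgroup (cartier_core p A P) A"
    by (intro additive_subgroup.intro subgroup.intro)
       (use carr add zero neg in \<open>auto simp: a_inv_def[symmetric]\<close>)
  thus ?thesis
    by (intro idealI ring_axioms additive_subgroup.a_subgroup)
       (use mult carr m_comm in \<open>auto\<close>)
qed

section \<open>Rings graded by projections\<close>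

text \<open>A grading is given by its projections \<open>\<pi> i\<close> onto the homogeneous components rather than by
  the graded pieces, so that components are available as terms. The last axiom says that an
  element is determined by its components; together with finiteness it yields the direct sum
  decomposition without mentioning sums.\<close>
locale graded_cring = cring R for R (structure) +
  fixes \<pi> :: "nat \<Rightarrow> 'a \<Rightarrow> 'a"
  assumes comp_closed [simp, intro]: "x \<in> carrier R \<Longrightarrow> \<pi> i x \<in> carrier R"
    and comp_add: "x \<in> carrier R \<Longrightarrow> y \<in> carrier R \<Longrightarrow> \<pi> i (x \<oplus> y) = \<pi> i x \<oplus> \<pi> i y"
    and comp_comp: "x \<in> carrier R \<Longrightarrow> \<pi> i (\<pi> j x) = (if i = j then \<pi> j x else \<zero>)"
    and comp_mult: "x \<in> carrier R \<Longrightarrow> y \<in> carrier R \<Longrightarrow>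
      \<pi> (i + j) (\<pi> i x \<otimes> \<pi> j y) = \<pi> i x \<otimes> \<pi> j y"
    and comp_finite: "x \<in> carrier R \<Longrightarrow> finite {i. \<pi> i x \<noteq> \<zero>}"
    and comp_eqI: "x \<in> carrier R \<Longrightarrow> y \<in> carrier R \<Longrightarrow> (\<And>i. \<pi> i x = \<pi> i y) \<Longrightarrow> x = y"
begin

definition supp :: "'a \<Rightarrow> nat set" where
  "supp x = {i. \<pi> i x \<noteq> \<zero>}"

definition piece :: "nat \<Rightarrow> 'a set" where
  "piece i = {x \<in> carrier R. \<pi> i x = x}"

lemma finite_supp: "x \<in> carrier R \<Longrightarrow> finite (supp x)"
  using comp_finite by (simp add: supp_def)

lemma comp_zero [simp]: "\<pi> i \<zero> = \<zero>"
  by (intro additive_zero) (auto intro: abelian_group_axioms comp_add)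

lemma comp_finsum:
  assumes "g \<in> F \<rightarrow> carrier R"
  shows "\<pi> i (\<Oplus>j\<in>F. g j) = (\<Oplus>j\<in>F. \<pi> i (g j))"
  using assms by (intro additive_finsum) (auto intro: abelian_group_axioms comp_add)

lemma pieceD: "x \<in> piece i \<Longrightarrow> x \<in> carrier R" "x \<in> piece i \<Longrightarrow> \<pi> i x = x"
  by (auto simp: piece_def)

lemma comp_in_piece [intro]: "x \<in> carrier R \<Longrightarrow> \<pi> i x \<in> piece i"
  by (simp add: piece_def comp_comp)

lemma zero_in_piece [intro, simp]: "\<zero> \<in> piece i"
  by (simp add: piece_def)

lemma comp_piece:
  assumes "x \<in> piece j"
  shows "\<pi> i x = (if i = j then x else \<zero>)"
  using assms comp_comp[of x i j] by (simp add: piece_def)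

lemma piece_add: "x \<in> piece i \<Longrightarrow> y \<in> piece i \<Longrightarrow> x \<oplus> y \<in> piece i"
  by (simp add: piece_def comp_add)

lemma piece_finsum: "g \<in> F \<rightarrow> piece i \<Longrightarrow> (\<Oplus>j\<in>F. g j) \<in> piece i"
proof (induction F rule: infinite_finite_induct)
  case (insert j F)
  hence "g j \<in> piece i" "g \<in> F \<rightarrow> piece i" by auto
  thus ?case
    using insert by (subst finsum_insert) (auto simp: Pi_iff pieceD intro!: piece_add)
qed auto

lemma piece_mult: "x \<in> piece i \<Longrightarrow> y \<in> piece j \<Longrightarrow> x \<otimes> y \<in> piece (i + j)"
  using comp_mult[of x y i j] by (auto simp: piece_def)

text \<open>Both sides have the same components.\<close>
lemma sum_comp:
  assumes x: "x \<in> carrier R" and F: "finite F" "supp x \<subseteq> F"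
  shows "(\<Oplus>i\<in>F. \<pi> i x) = x"
proof (rule comp_eqI)
  fix i
  have "\<pi> i (\<Oplus>j\<in>F. \<pi> j x) = (\<Oplus>j\<in>F. if i = j then \<pi> j x else \<zero>)"
    using x by (subst comp_finsum) (auto simp: comp_comp intro!: finsum_cong')
  also have "\<dots> = \<pi> i x"
  proof (cases "i \<in> F")
    case True
    thus ?thesis
      using x F by (subst finsum_singleton) auto
  next
    case False
    hence "(\<Oplus>j\<in>F. if i = j then \<pi> j x else \<zero>) = (\<Oplus>j\<in>F. \<zero>)"
      by (intro finsum_cong') auto
    thus ?thesis
      using False F subsetD[OF F(2), of i] by (auto simp: supp_def)
  qed
  finally show "\<pi> i (\<Oplus>j\<in>F. \<pi> j x) = \<pi> i x" .
qed (use x in \<open>auto simp: Pi_def\<close>)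

lemma homogeneous_induct [consumes 1, case_names piece add]:
  assumes x: "x \<in> carrier R"
    and "\<And>i x. x \<in> piece i \<Longrightarrow> P x"
    and "\<And>x y. x \<in> carrier R \<Longrightarrow> y \<in> carrier R \<Longrightarrow> P x \<Longrightarrow> P y \<Longrightarrow> P (x \<oplus> y)"
  shows "P x"
proof -
  have "finite F \<Longrightarrow> P (\<Oplus>i\<in>F. \<pi> i x)" for F
  proof (induction F rule: finite_induct)
    case empty
    show ?case using assms(2)[OF zero_in_piece] by simp
  next
    case (insert j F)
    thus ?case
      using x assms(2)[OF comp_in_piece[OF x]] by (auto intro!: assms(3))
  qed
  from this[OF finite_supp[OF x]] show ?thesis
    using sum_comp[OF x finite_supp[OF x]] by simp
qed

lemma comp_piece_mult:
  assumes r: "r \<in> piece u" and x: "x \<in> carrier R"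
  shows "\<pi> (u + i) (r \<otimes> x) = r \<otimes> \<pi> i x"
  using x
proof (induction rule: homogeneous_induct)
  case (piece j x)
  thus ?case
    using comp_piece[OF piece_mult[OF r piece], of "u + i"] comp_piece[OF piece, of i] pieceD[OF r]
    by auto
next
  case (add x y)
  thus ?case
    using pieceD[OF r] by (simp add: r_distr comp_add)
qed

lemma comp_piece_mult_less:
  assumes r: "r \<in> piece u" and x: "x \<in> carrier R" and i: "i < u"
  shows "\<pi> i (r \<otimes> x) = \<zero>"
  using x
proof (induction rule: homogeneous_induct)
  case (piece j x)
  thus ?case
    using comp_piece[OF piece_mult[OF r piece], of i] i by auto
next
  case (add x y)
  thus ?case
    using pieceD[OF r] by (simp add: r_distr comp_add)
qed

lemma piece_pow:
  assumes r: "r \<in> piece u" and "0 < n"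
  shows "r [^] n \<in> piece (n * u)"
  using \<open>0 < n\<close>
proof (induction n rule: nat_induct_non_zero)
  case (Suc n)
  thus ?case
    using piece_mult[OF Suc.IH r] by (simp add: add.commute)
qed (use r in \<open>auto simp: pieceD\<close>)

text \<open>The additive map that acts as \<open>\<kappa> i\<close> on the degree \<open>i\<close> piece.\<close>
definition glue :: "(nat \<Rightarrow> 'a \<Rightarrow> 'a) \<Rightarrow> 'a \<Rightarrow> 'a" where
  "glue \<kappa> x = (\<Oplus>i\<in>supp x. \<kappa> i (\<pi> i x))"

lemma glue_piece:
  assumes "\<And>i x. x \<in> piece i \<Longrightarrow> \<kappa> i x \<in> carrier R"
    and "\<And>i x y. x \<in> piece i \<Longrightarrow> y \<in> piece i \<Longrightarrow> \<kappa> i (x \<oplus> y) = \<kappa> i x \<oplus> \<kappa> i y"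
    and x: "x \<in> piece i"
  shows "glue \<kappa> x = \<kappa> i x"
proof (cases "x = \<zero>")
  case True
  have "\<kappa> i \<zero> \<oplus> \<kappa> i \<zero> = \<kappa> i \<zero>"
    using assms(2)[of \<zero> i \<zero>] by simp
  hence "\<kappa> i \<zero> = \<zero>"
    using assms(1)[of \<zero> i] by (simp add: add.l_cancel_one)
  thus ?thesis
    using True by (simp add: glue_def supp_def)
next
  case False
  hence "supp x = {i}"
    using x comp_piece[OF x] by (auto simp: supp_def)
  thus ?thesis
    using x assms(1)[OF x] by (simp add: glue_def pieceD Pi_def)
qed

lemma glue_eq_sum:
  assumes "\<And>i x. x \<in> piece i \<Longrightarrow> \<kappa> i x \<in> carrier R"
    and "\<And>i x y. x \<in> piece i \<Longrightarrow> y \<in> piece i \<Longrightarrow> \<kappa> i (x \<oplus> y) = \<kappa> i x \<oplus> \<kappa> i y"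
    and x: "x \<in> carrier R" and F: "finite F" "supp x \<subseteq> F"
  shows "glue \<kappa> x = (\<Oplus>i\<in>F. \<kappa> i (\<pi> i x))"
proof -
  have "\<kappa> i (\<pi> i x) = \<zero>" if "i \<notin> supp x" for i
    using glue_piece[of \<kappa>, OF assms(1,2) zero_in_piece, of i] that by (simp add: supp_def glue_def)
  thus ?thesis
    unfolding glue_def using F x assms(1)[OF comp_in_piece[OF x]]
    by (intro add.finprod_mono_neutral_cong_left) auto
qed

text \<open>The rule for \<open>q\<close>-th powers needs to be known for homogeneous arguments only: it is additive in
  \<open>x\<close> trivially and additive in \<open>r\<close> because taking \<open>q\<close>-th powers is. Multiplication by \<open>r\<^sup>q\<close>
  raises degrees by \<open>q u\<close>, whence the index on the left of the last assumption.\<close>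
lemma glue_in_frob_homs:
  assumes closed: "\<And>i x. x \<in> piece i \<Longrightarrow> \<kappa> i x \<in> carrier R"
    and additive: "\<And>i x y. x \<in> piece i \<Longrightarrow> y \<in> piece i \<Longrightarrow> \<kappa> i (x \<oplus> y) = \<kappa> i x \<oplus> \<kappa> i y"
    and frob_add: "\<And>a b. a \<in> carrier R \<Longrightarrow> b \<in> carrier R \<Longrightarrow> (a \<oplus> b) [^] q = a [^] q \<oplus> b [^] q"
    and q: "0 < (q::nat)"
    and semilinear: "\<And>u i r x. r \<in> piece u \<Longrightarrow> x \<in> piece i \<Longrightarrow>
      \<kappa> (q * u + i) (r [^] q \<otimes> x) = r \<otimes> \<kappa> i x"
  shows "glue \<kappa> \<in> frob_homs q R"
proof -
  have eq_sum: "glue \<kappa> x = (\<Oplus>i\<in>F. \<kappa> i (\<pi> i x))"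
    if "x \<in> carrier R" "finite F" "supp x \<subseteq> F" for x F
    using that by (intro glue_eq_sum closed additive)
  have on_piece: "glue \<kappa> x = \<kappa> i x" if "x \<in> piece i" for x i
    using that by (intro glue_piece closed additive)
  have glue_closed [simp]: "glue \<kappa> x \<in> carrier R" if "x \<in> carrier R" for x
    using that closed by (auto simp: glue_def intro!: finsum_closed)
  have glue_add: "glue \<kappa> (x \<oplus> y) = glue \<kappa> x \<oplus> glue \<kappa> y"
    if xy: "x \<in> carrier R" "y \<in> carrier R" for x y
  proof -
    define F where "F = supp x \<union> supp y \<union> supp (x \<oplus> y)"
    have sub: "supp x \<subseteq> F" "supp y \<subseteq> F"
      by (auto simp: F_def)
    have F: "finite F"
      using xy by (auto simp: F_def finite_supp)
    have "glue \<kappa> (x \<oplus> y) = (\<Oplus>i\<in>F. \<kappa> i (\<pi> i x) \<oplus> \<kappa> i (\<pi> i y))"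
      using xy F closed additive
      by (subst eq_sum[of _ F]) (auto simp: F_def comp_add comp_in_piece intro!: finsum_cong')
    also have "\<dots> = (\<Oplus>i\<in>F. \<kappa> i (\<pi> i x)) \<oplus> (\<Oplus>i\<in>F. \<kappa> i (\<pi> i y))"
      using xy closed by (intro finsum_addf) auto
    also have "\<dots> = glue \<kappa> x \<oplus> glue \<kappa> y"
      using eq_sum[OF xy(1) F sub(1)] eq_sum[OF xy(2) F sub(2)] by simp
    finally show ?thesis .
  qed
  have "glue \<kappa> (r [^] q \<otimes> x) = r \<otimes> glue \<kappa> x" if x: "x \<in> carrier R" and r: "r \<in> carrier R" for x r
    using r
  proof (induction rule: homogeneous_induct)
    case r: (piece u r)
    show ?case
      using x
    proof (induction rule: homogeneous_induct)
      case x: (piece i x)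
      have "r [^] q \<otimes> x \<in> piece (q * u + i)"
        using r x q by (intro piece_mult piece_pow)
      thus ?case
        using semilinear[OF r x] on_piece x by simp
    next
      case (add x y)
      thus ?case
        using r by (simp add: r_distr glue_add pieceD)
    qed
  next
    case (add r s)
    thus ?case
      using x by (simp add: frob_add l_distr glue_add)
  qed
  thus ?thesis
    using glue_add by (auto simp: frob_homs_def)
qed

section \<open>Homogeneity of Cartier cores\<close>

text \<open>The part of \<open>\<phi>\<close> of degree \<open>m - n / q\<close>: it sends degree \<open>i\<close> to degree \<open>j\<close> where
  \<open>q j + n = q m + i\<close>, and to zero if there is no such \<open>j\<close>. Its values in degree \<open>m\<close> come from
  arguments of degree \<open>n\<close> alone, which is how a single component of an argument can be isolated
  by a map that is linear over all of \<open>R\<close>.\<close>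
lemma truncate_frob_hom:
  assumes \<phi>: "\<phi> \<in> frob_homs q R" and q: "0 < q"
    and frob_add: "\<And>a b. a \<in> carrier R \<Longrightarrow> b \<in> carrier R \<Longrightarrow> (a \<oplus> b) [^] q = a [^] q \<oplus> b [^] q"
  obtains \<phi>' where "\<phi>' \<in> frob_homs q R"
    and "\<And>x. x \<in> piece n \<Longrightarrow> \<phi>' x = \<pi> m (\<phi> x)"
    and "\<And>x. x \<in> carrier R \<Longrightarrow> \<pi> m (\<phi>' x) = \<pi> m (\<phi> (\<pi> n x))"
proof -
  define \<kappa> where "\<kappa> i x = (if \<exists>j. q * j + n = q * m + i
    then \<pi> (THE j. q * j + n = q * m + i) (\<phi> x) else \<zero>)" for i x
  have \<kappa>_eq: "\<kappa> i x = \<pi> j (\<phi> x)" if "q * j + n = q * m + i" for i j x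
  proof -
    have "(THE j. q * j + n = q * m + i) = j"
      using that q by (intro the_equality) (auto simp flip: that)
    thus ?thesis using that by (auto simp: \<kappa>_def)
  qed
  have \<kappa>_zero: "\<kappa> i x = \<zero>" if "\<And>j. q * j + n \<noteq> q * m + i" for i x
    using that by (auto simp: \<kappa>_def)
  have closed: "\<kappa> i x \<in> carrier R" if "x \<in> piece i" for i x
    using that frob_homsD(1)[OF \<phi>] by (auto simp: \<kappa>_def pieceD)
  have additive: "\<kappa> i (x \<oplus> y) = \<kappa> i x \<oplus> \<kappa> i y" if "x \<in> piece i" "y \<in> piece i" for i x y
    using that frob_homsD(1,2)[OF \<phi>] by (auto simp: \<kappa>_def pieceD comp_add)
  have semilinear: "\<kappa> (q * u + i) (r [^] q \<otimes> x) = r \<otimes> \<kappa> i x"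
    if r: "r \<in> piece u" and x: "x \<in> piece i" for u i r x
  proof -
    have rx: "\<phi> (r [^] q \<otimes> x) = r \<otimes> \<phi> x" "r \<in> carrier R" "\<phi> x \<in> carrier R"
      using r x frob_homsD[OF \<phi>] by (auto simp: pieceD)
    (* Multiplication by r moves i to q u + i and j to u + j. In case b there is a target
       degree j for the product but none for x; then j is less than u, the degree of r, so the
       component of r * phi x in degree j vanishes. *)
    consider (a) j where "q * j + n = q * m + i"
      | (b) j where "q * j + n = q * m + (q * u + i)" "\<nexists>j. q * j + n = q * m + i"
      | (c) "\<nexists>j. q * j + n = q * m + i" "\<nexists>j. q * j + n = q * m + (q * u + i)"
      by blast
    thus ?thesis
    proof cases
      case a
      hence "q * (u + j) + n = q * m + (q * u + i)"
        by (simp add: algebra_simps)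
      from \<kappa>_eq[OF this] \<kappa>_eq[OF a] show ?thesis
        using comp_piece_mult[OF r rx(3)] rx by simp
    next
      case b
      have "j < u"
      proof (rule ccontr)
        assume "\<not> j < u"
        then obtain k where "j = u + k" using le_Suc_ex[of u j] by auto
        with b(1) have "q * k + n = q * m + i" by (simp add: algebra_simps)
        with b(2) show False by blast
      qed
      have "\<kappa> (q * u + i) (r [^] q \<otimes> x) = \<zero>"
        using \<kappa>_eq[OF b(1)] comp_piece_mult_less[OF r rx(3) \<open>j < u\<close>] rx by simp
      moreover have "\<kappa> i x = \<zero>"
        using b(2) by (intro \<kappa>_zero) blast
      ultimately show ?thesis using rx by simp
    next
      case c
      have "\<kappa> i x = \<zero>" "\<kappa> (q * u + i) (r [^] q \<otimes> x) = \<zero>"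
        using c by (intro \<kappa>_zero; blast)+
      thus ?thesis using rx by simp
    qed
  qed
  have hom: "glue \<kappa> \<in> frob_homs q R"
    by (rule glue_in_frob_homs) (use closed additive frob_add q semilinear in auto)
  have on_piece: "glue \<kappa> x = \<kappa> i x" if "x \<in> piece i" for x i
    using that by (intro glue_piece closed additive)
  have eq_n: "glue \<kappa> x = \<pi> m (\<phi> x)" if "x \<in> piece n" for x
    using on_piece[OF that] \<kappa>_eq[of m n x] by simp
  have proj: "\<pi> m (glue \<kappa> x) = \<pi> m (\<phi> (\<pi> n x))" if "x \<in> carrier R" for x
    using that
  proof (induction rule: homogeneous_induct)
    case (piece i x)
    note carr = frob_homsD(1)[OF \<phi> pieceD(1)[OF piece]]
    show ?case
    proof (cases "i = n")
      case True
      thus ?thesis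
        using eq_n piece carr by (simp add: comp_comp pieceD)
    next
      case False
      have "\<pi> m (\<kappa> i x) = \<zero>"
      proof (cases "\<exists>j. q * j + n = q * m + i")
        case True
        then obtain j where j: "q * j + n = q * m + i" ..
        with False have "m \<noteq> j" by auto
        thus ?thesis
          using \<kappa>_eq[OF j] carr by (simp add: comp_comp)
      qed (simp add: \<kappa>_def)
      thus ?thesis
        using False on_piece[OF piece] comp_piece[OF piece, of n] frob_homs_zero[OF is_cring \<phi>] by simp
    qed
  next
    case (add x y)
    thus ?case
      using frob_homsD(1,2)[OF \<phi>] frob_homsD(1,2)[OF hom] by (simp add: comp_add)
  qed
  show ?thesis
    using that[OF hom eq_n proj] .
qed

definition graded_subset :: "'a set \<Rightarrow> bool" where
  "graded_subset P \<longleftrightarrow> (\<forall>x\<in>P. \<forall>i. \<pi> i x \<in> P)"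

lemma graded_subset_memI:
  assumes "ideal P R" "x \<in> carrier R" "\<And>i. \<pi> i x \<in> P"
  shows "x \<in> P"
proof -
  interpret P: ideal P R by fact
  have "finite F \<Longrightarrow> (\<Oplus>i\<in>F. \<pi> i x) \<in> P" for F
    by (induction F rule: finite_induct)
       (use assms in \<open>auto intro: P.a_closed additive_subgroup.zero_closed[OF P.is_additive_subgroup]\<close>)
  from this[OF finite_supp[OF assms(2)]] show ?thesis
    using sum_comp[OF assms(2) finite_supp[OF assms(2)]] by simp
qed

text \<open>This ideal contains every set of homogeneous elements of \<open>P\<close>, hence the ideal they generate.\<close>
lemma graded_part_ideal:
  assumes "ideal P R"
  shows "ideal {x \<in> carrier R. \<forall>i. \<pi> i x \<in> P} R" (is "ideal ?Q R")
proof -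
  interpret P: ideal P R by fact
  note zero = additive_subgroup.zero_closed[OF P.is_additive_subgroup]
  have mult: "r \<otimes> x \<in> ?Q" if x: "x \<in> ?Q" and r: "r \<in> carrier R" for x r
    using r
  proof (induction rule: homogeneous_induct)
    case (piece u r)
    have "\<pi> i (r \<otimes> x) \<in> P" for i
    proof (cases "i < u")
      case True
      thus ?thesis
        using comp_piece_mult_less[OF piece] x zero by simp
    next
      case False
      then obtain k where "i = u + k" using le_Suc_ex[of u i] by auto
      thus ?thesis
        using comp_piece_mult[OF piece] x pieceD[OF piece] by (auto intro: P.I_l_closed)
    qed
    thus ?case using x pieceD[OF piece] by simp
  next
    case (add r s)
    thus ?case
      using x by (auto simp: l_distr comp_add intro: P.a_closed)
  qed
  have neg: "\<ominus> x \<in> ?Q" if "x \<in> ?Q" for x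
    using mult[OF that, of "\<ominus> \<one>"] that by (simp add: l_minus)
  have "additive_subgroup ?Q R"
    by (intro additive_subgroup.intro subgroup.intro)
       (use zero neg in \<open>auto simp: a_inv_def[symmetric] comp_add intro: P.a_closed\<close>)
  thus ?thesis
    by (intro idealI ring_axioms additive_subgroup.a_subgroup)
       (use mult m_comm in \<open>auto\<close>)
qed

lemma genideal_graded:
  assumes "\<And>x. x \<in> Y \<Longrightarrow> \<exists>i. x \<in> piece i"
  shows "graded_subset (Idl\<^bsub>R\<^esub> Y)"
proof -
  have Y: "Y \<subseteq> carrier R" using assms pieceD(1) by blast
  interpret P: ideal "Idl\<^bsub>R\<^esub> Y" R by (rule genideal_ideal[OF Y])
  have "Y \<subseteq> {x \<in> carrier R. \<forall>i. \<pi> i x \<in> Idl\<^bsub>R\<^esub> Y}"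
  proof
    fix x assume x: "x \<in> Y"
    then obtain j where j: "x \<in> piece j" using assms by blast
    have "x \<in> Idl\<^bsub>R\<^esub> Y" using genideal_self[OF Y] x by blast
    thus "x \<in> {x \<in> carrier R. \<forall>i. \<pi> i x \<in> Idl\<^bsub>R\<^esub> Y}"
      using comp_piece[OF j] pieceD[OF j] additive_subgroup.zero_closed[OF P.is_additive_subgroup]
      by auto
  qed
  from genideal_minimal[OF graded_part_ideal[OF P.ideal_axioms] this]
  show ?thesis by (auto simp: graded_subset_def)
qed

text \<open>To see that \<open>\<phi>\<close> sends the degree \<open>n\<close> component of an element \<open>a\<close> of the core into \<open>P\<close>, look at
  each degree \<open>m\<close> of the value separately: it is also the degree \<open>m\<close> part of \<open>\<phi>' a \<in> P\<close> for the
  map \<open>\<phi>'\<close> truncated at \<open>n\<close> and \<open>m\<close>.\<close>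
lemma cartier_core_graded:
  assumes P: "ideal P R" "graded_subset P" and p: "0 < p"
    and frob_add: "\<And>a b e. a \<in> carrier R \<Longrightarrow> b \<in> carrier R \<Longrightarrow>
      (a \<oplus> b) [^] (p ^ e) = a [^] (p ^ e) \<oplus> b [^] (p ^ e)"
  shows "graded_subset (cartier_core p R P)"
  unfolding graded_subset_def
proof (intro ballI allI)
  fix a n assume a: "a \<in> cartier_core p R P"
  hence a': "a \<in> carrier R" by (simp add: cartier_core_alt)
  have "\<phi> (\<pi> n a) \<in> P" if \<phi>: "\<phi> \<in> frob_homs (p ^ e) R" and "e > 0" for e \<phi>
  proof (rule graded_subset_memI[OF P(1)])
    fix m
    obtain \<phi>' where \<phi>': "\<phi>' \<in> frob_homs (p ^ e) R"
      "\<pi> m (\<phi>' a) = \<pi> m (\<phi> (\<pi> n a))"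
      using truncate_frob_hom[OF \<phi>] p frob_add a' by (metis zero_less_power)
    have "\<phi>' a \<in> P"
      using a \<phi>'(1) \<open>e > 0\<close> by (simp add: cartier_core_alt)
    thus "\<pi> m (\<phi> (\<pi> n a)) \<in> P"
      using P(2) \<phi>'(2) unfolding graded_subset_def by metis
  qed (use a' frob_homsD(1)[OF \<phi>] in auto)
  thus "\<pi> n a \<in> cartier_core p R P"
    using a' by (simp add: cartier_core_alt)
qed

lemma homogeneous_components_eq:
  assumes "f \<in> carrier R" "\<And>i. G i = piece i"
  shows "homogeneous_components R G f = (\<lambda>i. \<pi> i f)"
  unfolding homogeneous_components_def
proof (rule the_equality)
  show "(\<forall>i. \<pi> i f \<in> G i) \<and> finite {i. \<pi> i f \<noteq> \<zero>} \<and> f = (\<Oplus>i\<in>{i. \<pi> i f \<noteq> \<zero>}. \<pi> i f)"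
    using assms sum_comp[OF assms(1) finite_supp[OF assms(1)]] finite_supp[OF assms(1)]
    by (auto simp: supp_def)
next
  fix c assume c: "(\<forall>i. c i \<in> G i) \<and> finite {i. c i \<noteq> \<zero>} \<and> f = (\<Oplus>i\<in>{i. c i \<noteq> \<zero>}. c i)"
  have cp: "c i \<in> piece i" for i using c assms by simp
  have carr: "c i \<in> carrier R" for i using pieceD(1)[OF cp] .
  have "\<pi> i f = c i" for i
  proof -
    define F where "F = insert i {i. c i \<noteq> \<zero>}"
    have F: "finite F" "i \<in> F" using c by (auto simp: F_def)
    have "f = (\<Oplus>i\<in>F. c i)"
      unfolding c[THEN conjunct2, THEN conjunct2]
      by (rule add.finprod_mono_neutral_cong_left) (use c cp pieceD in \<open>auto simp: F_def\<close>)
    hence "\<pi> i f = (\<Oplus>j\<in>F. \<pi> i (c j))"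
      using carr by (subst comp_finsum[symmetric]) auto
    also have "\<dots> = (\<Oplus>j\<in>F. if i = j then c j else \<zero>)"
      using carr comp_piece[OF cp] by (intro finsum_cong') auto
    also have "\<dots> = c i"
      using carr F by (subst finsum_singleton) auto
    finally show ?thesis .
  qed
  thus "c = (\<lambda>i. \<pi> i f)" by auto
qed

end

section \<open>The total grading of a polynomial ring\<close>

text \<open>The total grading on \<open>R[t]\<close> built on this grading of \<open>R\<close> is the grading by the degree in \<open>t\<close>.\<close>
lemma (in cring) trivial_grading: "graded_cring R (\<lambda>i x. if i = (0::nat) then x else \<zero>)"
proof
  fix x y assume "x \<in> carrier R" "y \<in> carrier R"
    and *: "\<And>i. (if i = (0::nat) then x else \<zero>) = (if i = 0 then y else \<zero>)"
  show "x = y" using *[of 0] by simp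
qed auto

text \<open>In a form of total degree \<open>n\<close> the coefficient of \<open>t\<^sup>l\<close> has degree \<open>n - l\<close>.\<close>
definition up_comp :: "('a, 'm) ring_scheme \<Rightarrow> (nat \<Rightarrow> 'a \<Rightarrow> 'a) \<Rightarrow> nat \<Rightarrow> (nat \<Rightarrow> 'a) \<Rightarrow> nat \<Rightarrow> 'a" where
  "up_comp R \<pi> n g = (\<lambda>l. if l \<le> n then \<pi> (n - l) (g l) else \<zero>\<^bsub>R\<^esub>)"

lemma (in UP) carrier_P: "carrier P = up R"
  unfolding P_def UP_def by simp

lemma (in UP) coeff_P: "g \<in> carrier P \<Longrightarrow> up_ring.coeff P g l = g l"
  unfolding P_def UP_def by simp

locale graded_UP = UP_cring R P + graded_cring R \<pi> for R (structure) and \<pi> and P (structure)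
begin

lemma up_comp_closed [simp]:
  assumes g: "g \<in> carrier P"
  shows "up_comp R \<pi> n g \<in> carrier P"
proof -
  have "g l \<in> carrier R" for l
    using g coeff_closed[OF g, of l] coeff_P[OF g] by simp
  hence "up_comp R \<pi> n g l \<in> carrier R" for l
    by (simp add: up_comp_def)
  moreover have "bound \<zero> n (up_comp R \<pi> n g)"
    by (rule bound.intro) (simp add: up_comp_def)
  ultimately show ?thesis
    unfolding carrier_P by (intro mem_upI exI[of _ n])
qed

lemma coeff_up_comp:
  assumes g: "g \<in> carrier P"
  shows "up_ring.coeff P (up_comp R \<pi> n g) l = (if l \<le> n then \<pi> (n - l) (up_ring.coeff P g l) else \<zero>)"
  using g by (simp add: coeff_P) (simp add: up_comp_def)

lemma UP_graded: "graded_cring P (up_comp R \<pi>)"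
proof (intro graded_cring.intro graded_cring_axioms.intro)
  show "cring P" ..
next
  fix x y :: "nat \<Rightarrow> 'a" and i
  assume "x \<in> carrier P" "y \<in> carrier P"
  thus "up_comp R \<pi> i (x \<oplus>\<^bsub>P\<^esub> y) = up_comp R \<pi> i x \<oplus>\<^bsub>P\<^esub> up_comp R \<pi> i y"
    by (intro up_eqI) (auto simp: coeff_up_comp comp_add)
next
  fix x :: "nat \<Rightarrow> 'a" and i j
  assume "x \<in> carrier P"
  thus "up_comp R \<pi> i (up_comp R \<pi> j x) = (if i = j then up_comp R \<pi> j x else \<zero>\<^bsub>P\<^esub>)"
    by (intro up_eqI) (auto simp: coeff_up_comp comp_comp)
next
  fix x y :: "nat \<Rightarrow> 'a" and i j
  assume xy: "x \<in> carrier P" "y \<in> carrier P"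
  define f g where "f = up_comp R \<pi> i x" and "g = up_comp R \<pi> j y"
  have fg: "f \<in> carrier P" "g \<in> carrier P"
    using xy by (auto simp: f_def g_def)
  show "up_comp R \<pi> (i + j) (f \<otimes>\<^bsub>P\<^esub> g) = f \<otimes>\<^bsub>P\<^esub> g"
  proof (rule up_eqI)
    fix l
    have f: "up_ring.coeff P f k \<in> piece (i - k)" "k > i \<Longrightarrow> up_ring.coeff P f k = \<zero>" for k
      using coeff_closed[OF xy(1)] by (simp_all add: f_def coeff_up_comp[OF xy(1)] comp_in_piece)
    have g: "up_ring.coeff P g k \<in> piece (j - k)" "k > j \<Longrightarrow> up_ring.coeff P g k = \<zero>" for k
      using coeff_closed[OF xy(2)] by (simp_all add: g_def coeff_up_comp[OF xy(2)] comp_in_piece)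
    show "up_ring.coeff P (up_comp R \<pi> (i + j) (f \<otimes>\<^bsub>P\<^esub> g)) l = up_ring.coeff P (f \<otimes>\<^bsub>P\<^esub> g) l"
    proof (cases "l \<le> i + j")
      case True
      have "up_ring.coeff P f k \<otimes> up_ring.coeff P g (l - k) \<in> piece (i + j - l)" if "k \<le> l" for k
      proof (cases "k \<le> i \<and> l - k \<le> j")
        case True
        hence "i - k + (j - (l - k)) = i + j - l" using that by arith
        thus ?thesis using piece_mult[OF f(1)[of k] g(1)[of "l - k"]] by simp
      next
        case False
        hence "up_ring.coeff P f k = \<zero> \<or> up_ring.coeff P g (l - k) = \<zero>"
          using f(2)[of k] g(2)[of "l - k"] by linarith
        hence "up_ring.coeff P f k \<otimes> up_ring.coeff P g (l - k) = \<zero>"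
          using coeff_closed[OF fg(1), of k] coeff_closed[OF fg(2), of "l - k"] by fastforce
        thus ?thesis by simp
      qed
      hence "up_ring.coeff P (f \<otimes>\<^bsub>P\<^esub> g) l \<in> piece (i + j - l)"
        unfolding coeff_mult[OF fg] by (intro piece_finsum) simp
      thus ?thesis
        using True pieceD(2) by (simp only: coeff_up_comp[OF P.m_closed[OF fg]] if_True)
    next
      case False
      have "up_ring.coeff P f k \<otimes> up_ring.coeff P g (l - k) = \<zero>" if "k \<le> l" for k
      proof -
        have "k > i \<or> l - k > j" using that False by arith
        thus ?thesis
          using f(2)[of k] g(2)[of "l - k"] coeff_closed[OF fg(1), of k]
            coeff_closed[OF fg(2), of "l - k"] by fastforce
      qed
      hence "up_ring.coeff P (f \<otimes>\<^bsub>P\<^esub> g) l = \<zero>"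
        unfolding coeff_mult[OF fg] by (intro R.add.finprod_one_eqI) simp
      thus ?thesis
        using False by (simp only: coeff_up_comp[OF P.m_closed[OF fg]] if_False)
    qed
  qed (use fg in auto)
next
  fix x assume x: "x \<in> carrier P"
  then obtain N where N: "bound \<zero> N x" by (auto simp: carrier_P)
  have "{i. up_comp R \<pi> i x \<noteq> \<zero>\<^bsub>P\<^esub>} \<subseteq> (\<Union>l\<le>N. (\<lambda>i. l + i) ` supp (up_ring.coeff P x l))"
  proof
    fix i assume "i \<in> {i. up_comp R \<pi> i x \<noteq> \<zero>\<^bsub>P\<^esub>}"
    then obtain l where l: "up_ring.coeff P (up_comp R \<pi> i x) l \<noteq> \<zero>"
      using x up_eqI[of "up_comp R \<pi> i x" "\<zero>\<^bsub>P\<^esub>"] by auto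
    hence li: "l \<le> i" "\<pi> (i - l) (up_ring.coeff P x l) \<noteq> \<zero>"
      using x by (auto simp: coeff_up_comp split: if_splits)
    hence "up_ring.coeff P x l \<noteq> \<zero>" by auto
    hence "l \<le> N"
      using N x by (auto simp: coeff_P bound_def not_less[symmetric])
    moreover have "i = l + (i - l)" "i - l \<in> supp (up_ring.coeff P x l)"
      using li by (auto simp: supp_def)
    ultimately show "i \<in> (\<Union>l\<le>N. (\<lambda>i. l + i) ` supp (up_ring.coeff P x l))"
      by blast
  qed
  moreover have "finite (\<Union>l\<le>N. (\<lambda>i. l + i) ` supp (up_ring.coeff P x l))"
    using finite_supp[OF coeff_closed[OF x]] by (intro finite_UN_I finite_imageI) auto
  ultimately show "finite {i. up_comp R \<pi> i x \<noteq> \<zero>\<^bsub>P\<^esub>}"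
    by (rule finite_subset)
next
  fix x y :: "nat \<Rightarrow> 'a"
  assume xy: "x \<in> carrier P" "y \<in> carrier P"
    and eq: "\<And>i. up_comp R \<pi> i x = up_comp R \<pi> i y"
  show "x = y"
  proof (rule up_eqI)
    fix l
    show "up_ring.coeff P x l = up_ring.coeff P y l"
    proof (rule comp_eqI)
      fix i
      have "up_ring.coeff P (up_comp R \<pi> (l + i) x) l = up_ring.coeff P (up_comp R \<pi> (l + i) y) l"
        using eq by simp
      thus "\<pi> i (up_ring.coeff P x l) = \<pi> i (up_ring.coeff P y l)"
        using xy by (simp add: coeff_up_comp)
    qed (use xy in auto)
  qed (use xy in auto)
qed auto

end

sublocale graded_UP \<subseteq> TG: graded_cring P "up_comp R \<pi>"
  by (rule UP_graded)

context UP_cring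
begin

lemma dehomogenization_hom: "ring_hom_cring P R (dehomogenization R)"
proof -
  interpret UP_pre_univ_prop R R id P
    by unfold_locales simp
  show ?thesis
    unfolding dehomogenization_def
    by unfold_locales (rule eval_ring_hom, simp)
qed

lemma dehomogenization_monom [simp]:
  assumes "a \<in> carrier R"
  shows "dehomogenization R (up_ring.monom P a n) = a"
proof -
  interpret UP_pre_univ_prop R R id P
    by unfold_locales simp
  show ?thesis
    unfolding dehomogenization_def using assms by (simp add: eval_monom)
qed

lemma sum_monom_coeff_eq:
  assumes "g \<in> carrier P" "\<And>l. l > N \<Longrightarrow> up_ring.coeff P g l = \<zero>"
  shows "(\<Oplus>\<^bsub>P\<^esub>l\<in>{..N}. up_ring.monom P (up_ring.coeff P g l) l) = g"
  using assms by (intro up_repr_le deg_aboveI)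

lemma dehomogenization_coeff:
  assumes "g \<in> carrier P" "\<And>l. l > N \<Longrightarrow> up_ring.coeff P g l = \<zero>"
  shows "dehomogenization R g = (\<Oplus>l\<in>{..N}. up_ring.coeff P g l)"
proof -
  interpret \<delta>: ring_hom_cring P R "dehomogenization R"
    by (rule dehomogenization_hom)
  have "dehomogenization R g =
      dehomogenization R (\<Oplus>\<^bsub>P\<^esub>l\<in>{..N}. up_ring.monom P (up_ring.coeff P g l) l)"
    using sum_monom_coeff_eq[OF assms] by simp
  also have "\<dots> = (\<Oplus>l\<in>{..N}. up_ring.coeff P g l)"
    using assms(1) by (subst \<delta>.hom_finsum) (auto simp: o_def)
  finally show ?thesis .
qed

end

context graded_UP
begin

abbreviation \<delta> :: "(nat \<Rightarrow> 'a) \<Rightarrow> 'a" where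
  "\<delta> \<equiv> dehomogenization R"

lemma coeff_total_piece:
  assumes "g \<in> TG.piece n"
  shows "up_ring.coeff P g l \<in> piece (n - l)"
    and "l > n \<Longrightarrow> up_ring.coeff P g l = \<zero>"
proof -
  have g: "g \<in> carrier P" "up_comp R \<pi> n g = g"
    using TG.pieceD[OF assms] .
  have eq: "up_ring.coeff P g l = (if l \<le> n then \<pi> (n - l) (up_ring.coeff P g l) else \<zero>)"
    using coeff_up_comp[OF g(1), of n l] unfolding g(2) .
  have "\<pi> (n - l) (up_ring.coeff P g l) \<in> piece (n - l)"
    by (rule comp_in_piece) (rule coeff_closed[OF g(1)])
  thus "up_ring.coeff P g l \<in> piece (n - l)"
    by (subst eq) auto
  show "up_ring.coeff P g l = \<zero>" if "l > n"
    using that by (subst eq) auto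
qed

text \<open>For homogeneous \<open>g\<close> of degree \<open>n\<close> the coefficient of \<open>t\<^sup>l\<close> is homogeneous of degree \<open>n - l\<close>, so
  the coefficients have different degrees and can be read off their sum \<open>\<delta> g\<close>.\<close>
lemma comp_dehomogenization:
  assumes g: "g \<in> TG.piece n"
  shows "\<pi> i (\<delta> g) = (if i \<le> n then up_ring.coeff P g (n - i) else \<zero>)"
proof -
  have carr: "up_ring.coeff P g l \<in> carrier R" for l
    using coeff_closed[OF TG.pieceD(1)[OF g]] .
  have "\<delta> g = (\<Oplus>l\<in>{..n}. up_ring.coeff P g l)"
    by (rule dehomogenization_coeff) (use coeff_total_piece[OF g] TG.pieceD[OF g] in auto)
  hence "\<pi> i (\<delta> g) = (\<Oplus>l\<in>{..n}. \<pi> i (up_ring.coeff P g l))"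
    using carr by (simp add: comp_finsum)
  also have "\<dots> = (\<Oplus>l\<in>{..n}. if i = n - l then up_ring.coeff P g l else \<zero>)"
    using carr comp_piece[OF coeff_total_piece(1)[OF g]] by (intro R.finsum_cong') auto
  also have "\<dots> = (if i \<le> n then up_ring.coeff P g (n - i) else \<zero>)"
  proof (cases "i \<le> n")
    case True
    have "(\<Oplus>l\<in>{..n}. if i = n - l then up_ring.coeff P g l else \<zero>) =
        (\<Oplus>l\<in>{..n}. if n - i = l then up_ring.coeff P g l else \<zero>)"
      using carr True by (intro R.finsum_cong') auto
    thus ?thesis
      using carr True by (subst (asm) R.finsum_singleton) auto
  next
    case False
    thus ?thesis
      using carr by (auto intro!: R.add.finprod_one_eqI)
  qed
  finally show ?thesis .
qed

lemma total_piece_eqI: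
  assumes "g \<in> TG.piece n" "h \<in> TG.piece n" "\<delta> g = \<delta> h"
  shows "g = h"
proof (rule up_eqI)
  fix l
  show "up_ring.coeff P g l = up_ring.coeff P h l"
  proof (cases "l \<le> n")
    case True
    hence "n - (n - l) = l" by simp
    thus ?thesis
      using comp_dehomogenization[OF assms(1), of "n - l"] comp_dehomogenization[OF assms(2), of "n - l"]
        assms(3) by simp
  next
    case False
    thus ?thesis
      using coeff_total_piece(2)[OF assms(1)] coeff_total_piece(2)[OF assms(2)] by simp
  qed
qed (use assms TG.pieceD in auto)

lemma monom_total_piece:
  assumes a: "a \<in> piece i"
  shows "up_ring.monom P a k \<in> TG.piece (i + k)"
proof -
  note a' = pieceD[OF a]
  have "up_comp R \<pi> (i + k) (up_ring.monom P a k) = up_ring.monom P a k"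
    by (rule up_eqI) (use a' in \<open>auto simp: coeff_up_comp\<close>)
  thus ?thesis
    using a' by (simp add: TG.piece_def)
qed

text \<open>Comparing degrees in \<open>x = x 1\<close> for homogeneous \<open>x\<close> shows that the degree zero part of \<open>1\<close> is a
  unit element as well.\<close>
lemma one_in_piece: "\<one> \<in> piece 0"
proof -
  have "\<pi> 0 \<one> \<otimes> x = x" if "x \<in> carrier R" for x
    using that
  proof (induction rule: homogeneous_induct)
    case (piece i x)
    show ?case
      using comp_piece_mult[OF piece, of \<one> 0] pieceD[OF piece]
      by (simp add: R.m_comm[of "\<pi> 0 \<one>"])
  qed (simp add: R.r_distr)
  from this[of \<one>] show ?thesis by (simp add: piece_def)
qed

section \<open>Transporting maps along dehomogenization\<close>

text \<open>For \<open>s\<close> of degree \<open>i\<close> one would like to use \<open>s t\<^bsup>n - i\<^esup>\<close>, which has total degree \<open>n\<close>. The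
  exponent \<open>n + (q - 1) i\<close> differs from \<open>n - i\<close> by \<open>q i\<close> and is never negative; the extra factor
  \<open>(t\<^sup>i)\<^sup>q\<close> leaves \<open>\<phi>\<close> as \<open>t\<^sup>i\<close> and becomes \<open>1\<close> under \<open>\<delta>\<close>.\<close>
lemma descend_frob_hom:
  assumes \<phi>: "\<phi> \<in> frob_homs q P" and q: "0 < q"
    and frob_add: "\<And>a b. a \<in> carrier R \<Longrightarrow> b \<in> carrier R \<Longrightarrow> (a \<oplus> b) [^] q = a [^] q \<oplus> b [^] q"
  obtains \<psi> where "\<psi> \<in> frob_homs q R" "\<And>a. a \<in> TG.piece n \<Longrightarrow> \<psi> (\<delta> a) = \<delta> (\<phi> a)"
proof -
  interpret \<delta>: ring_hom_cring P R "dehomogenization R"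
    by (rule dehomogenization_hom)
  define \<kappa> where "\<kappa> i s = \<delta> (\<phi> (up_ring.monom P s (n + (q - 1) * i)))" for i s
  have closed: "\<kappa> i s \<in> carrier R" if "s \<in> piece i" for i s
    using frob_homsD(1)[OF \<phi>] pieceD[OF that] by (auto simp: \<kappa>_def)
  have additive: "\<kappa> i (s \<oplus> t) = \<kappa> i s \<oplus> \<kappa> i t" if "s \<in> piece i" "t \<in> piece i" for i s t
    using frob_homsD(1,2)[OF \<phi>] pieceD[OF that(1)] pieceD[OF that(2)]
    by (auto simp: \<kappa>_def)
  have semilinear: "\<kappa> (q * u + i) (r [^] q \<otimes> s) = r \<otimes> \<kappa> i s"
    if r: "r \<in> piece u" and s: "s \<in> piece i" for u i r s
  proof -
    note carr = pieceD(1)[OF r] pieceD(1)[OF s]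
    have "n + (q - 1) * (q * u + i) = (q - 1) * u * q + (n + (q - 1) * i)"
      by (simp add: algebra_simps)
    hence "up_ring.monom P (r [^] q \<otimes> s) (n + (q - 1) * (q * u + i)) =
        up_ring.monom P r ((q - 1) * u) [^]\<^bsub>P\<^esub> q \<otimes>\<^bsub>P\<^esub> up_ring.monom P s (n + (q - 1) * i)"
      using carr by (simp only: monom_pow monom_mult R.nat_pow_closed)
    thus ?thesis
      using carr frob_homsD(1)[OF \<phi>] by (simp add: \<kappa>_def frob_homsD(3)[OF \<phi>])
  qed
  have hom: "glue \<kappa> \<in> frob_homs q R"
    by (rule glue_in_frob_homs) (use closed additive frob_add q semilinear in auto)
  have "glue \<kappa> (\<delta> a) = \<delta> (\<phi> a)" if a: "a \<in> TG.piece n" for a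
  proof -
    let ?c = "\<lambda>l. up_ring.coeff P a l"
    note a' = TG.pieceD(1)[OF a]
    have c [simp]: "?c l \<in> carrier R" for l
      using coeff_closed[OF a'] .
    have "supp (\<delta> a) \<subseteq> {..n}"
      using comp_dehomogenization[OF a] by (auto simp: supp_def split: if_splits)
    hence "glue \<kappa> (\<delta> a) = (\<Oplus>i\<in>{..n}. \<kappa> i (\<pi> i (\<delta> a)))"
      using a' by (intro glue_eq_sum closed additive) auto
    also have "\<dots> = (\<Oplus>i\<in>{..n}. \<delta> (\<phi> (up_ring.monom P (?c (n - i)) (n - i))))"
    proof (intro R.finsum_cong')
      fix i assume "i \<in> {..n}"
      hence i: "i \<le> n" by simp
      have "n + (q - 1) * i = i * q + (n - i)"
        using i q by (cases q) (auto simp: algebra_simps)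
      hence "up_ring.monom P (?c (n - i)) (n + (q - 1) * i) =
          up_ring.monom P \<one> i [^]\<^bsub>P\<^esub> q \<otimes>\<^bsub>P\<^esub> up_ring.monom P (?c (n - i)) (n - i)"
        by (simp add: monom_pow flip: monom_mult)
      hence "\<kappa> i (?c (n - i)) = \<delta> (\<phi> (up_ring.monom P (?c (n - i)) (n - i)))"
        using frob_homsD(1)[OF \<phi>] by (simp add: \<kappa>_def frob_homsD(3)[OF \<phi>])
      thus "\<kappa> i (\<pi> i (\<delta> a)) = \<delta> (\<phi> (up_ring.monom P (?c (n - i)) (n - i)))"
        using comp_dehomogenization[OF a, of i] i by simp
    qed (use frob_homsD(1)[OF \<phi>] in auto)
    also have "\<dots> = (\<Oplus>l\<in>(\<lambda>i. n - i) ` {..n}. \<delta> (\<phi> (up_ring.monom P (?c l) l)))"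
      using frob_homsD(1)[OF \<phi>] by (subst R.finsum_reindex) (auto simp: inj_on_def)
    also have "(\<lambda>i. n - i) ` {..n} = {..n}"
    proof -
      have "l \<in> (\<lambda>i. n - i) ` {..n}" if "l \<le> n" for l
        using that by (intro image_eqI[of _ _ "n - l"]) auto
      thus ?thesis by auto
    qed
    also have "(\<Oplus>l\<in>{..n}. \<delta> (\<phi> (up_ring.monom P (?c l) l))) =
        \<delta> (\<phi> (\<Oplus>\<^bsub>P\<^esub>l\<in>{..n}. up_ring.monom P (?c l) l))"
      using frob_homsD(1,2)[OF \<phi>]
      by (intro additive_finsum[where A = P and B = R and f = "\<lambda>x. \<delta> (\<phi> x)", symmetric]) (auto intro: P.abelian_group_axioms R.abelian_group_axioms)
    also have "(\<Oplus>\<^bsub>P\<^esub>l\<in>{..n}. up_ring.monom P (?c l) l) = a"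
      using coeff_total_piece(2)[OF a] by (intro sum_monom_coeff_eq a')
    finally show ?thesis .
  qed
  with hom show ?thesis using that by blast
qed

text \<open>Division of the exponent of \<open>t\<close> by \<open>q\<close> with rounding is compatible with multiplication by
  \<open>t\<^sup>q\<close>, and rounding is harmless since \<open>\<delta>\<close> forgets the exponent. The map is assembled along the
  grading by the degree in \<open>t\<close>, so \<open>\<psi>\<close> is applied to whole coefficients and need not respect the
  grading of \<open>R\<close>.\<close>
lemma extend_frob_hom:
  assumes \<psi>: "\<psi> \<in> frob_homs q R" and q: "0 < q"
    and frob_add: "\<And>a b. a \<in> carrier P \<Longrightarrow> b \<in> carrier P \<Longrightarrow>
      (a \<oplus>\<^bsub>P\<^esub> b) [^]\<^bsub>P\<^esub> q = a [^]\<^bsub>P\<^esub> q \<oplus>\<^bsub>P\<^esub> b [^]\<^bsub>P\<^esub> q"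
  obtains \<Phi> where "\<Phi> \<in> frob_homs q P" "\<And>g. g \<in> carrier P \<Longrightarrow> \<delta> (\<Phi> g) = \<psi> (\<delta> g)"
proof -
  interpret \<delta>: ring_hom_cring P R "dehomogenization R"
    by (rule dehomogenization_hom)
  define \<tau> where "\<tau> = (\<lambda>i x. if i = (0::nat) then x else \<zero>)"
  interpret T0: graded_cring R \<tau>
    unfolding \<tau>_def by (rule R.trivial_grading)
  interpret T: graded_UP R \<tau> P
    by unfold_locales
  have T_piece: "g \<in> carrier P" "g = up_ring.monom P (up_ring.coeff P g m) m"
    if "g \<in> T.TG.piece m" for g m
  proof -
    show g: "g \<in> carrier P" by (rule T.TG.pieceD(1)[OF that])
    show "g = up_ring.monom P (up_ring.coeff P g m) m"
    proof (rule up_eqI)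
      fix l
      have "up_ring.coeff P g l = (if l \<le> m then \<tau> (m - l) (up_ring.coeff P g l) else \<zero>)"
        using T.coeff_up_comp[OF g, of m l] unfolding T.TG.pieceD(2)[OF that] .
      thus "up_ring.coeff P g l = up_ring.coeff P (up_ring.monom P (up_ring.coeff P g m) m) l"
        using g by (auto simp: \<tau>_def split: if_splits)
    qed (use g in auto)
  qed
  note \<psi>_closed = frob_homsD(1)[OF \<psi>]
  define \<kappa> where "\<kappa> m g = up_ring.monom P (\<psi> (up_ring.coeff P g m)) (m div q)" for m g
  have closed: "\<kappa> m g \<in> carrier P" if "g \<in> T.TG.piece m" for m g
    using T_piece(1)[OF that] \<psi>_closed by (simp add: \<kappa>_def)
  have additive: "\<kappa> m (g \<oplus>\<^bsub>P\<^esub> h) = \<kappa> m g \<oplus>\<^bsub>P\<^esub> \<kappa> m h"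
    if "g \<in> T.TG.piece m" "h \<in> T.TG.piece m" for m g h
    using T_piece(1)[OF that(1)] T_piece(1)[OF that(2)] \<psi>_closed
    by (simp add: \<kappa>_def frob_homsD(2)[OF \<psi>])
  have \<kappa>_monom: "\<kappa> m (up_ring.monom P a m) = up_ring.monom P (\<psi> a) (m div q)" if "a \<in> carrier R" for a m
    using that by (simp add: \<kappa>_def)
  have semilinear: "\<kappa> (q * u + i) (r [^]\<^bsub>P\<^esub> q \<otimes>\<^bsub>P\<^esub> x) = r \<otimes>\<^bsub>P\<^esub> \<kappa> i x"
    if r: "r \<in> T.TG.piece u" and x: "x \<in> T.TG.piece i" for u i r x
  proof -
    obtain a where a: "a \<in> carrier R" "r = up_ring.monom P a u"
      using T_piece[OF r] coeff_closed by blast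
    obtain b where b: "b \<in> carrier R" "x = up_ring.monom P b i"
      using T_piece[OF x] coeff_closed by blast
    have "r [^]\<^bsub>P\<^esub> q \<otimes>\<^bsub>P\<^esub> x = up_ring.monom P (a [^] q \<otimes> b) (q * u + i)"
      using a b by (simp add: monom_pow mult.commute)
    hence "\<kappa> (q * u + i) (r [^]\<^bsub>P\<^esub> q \<otimes>\<^bsub>P\<^esub> x) = up_ring.monom P (a \<otimes> \<psi> b) (u + i div q)"
      using a b q by (simp add: \<kappa>_monom frob_homsD(3)[OF \<psi>] del: monom_mult)
    also have "\<dots> = r \<otimes>\<^bsub>P\<^esub> \<kappa> i x"
      using a b \<psi>_closed by (simp add: \<kappa>_monom)
    finally show ?thesis .
  qed
  have hom: "T.TG.glue \<kappa> \<in> frob_homs q P"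
    by (rule T.TG.glue_in_frob_homs) (use closed additive frob_add q semilinear in auto)
  have "\<delta> (T.TG.glue \<kappa> g) = \<psi> (\<delta> g)" if "g \<in> carrier P" for g
    using that
  proof (induction rule: T.TG.homogeneous_induct)
    case (piece m g)
    then obtain a where a: "a \<in> carrier R" "g = up_ring.monom P a m"
      using T_piece[OF piece] coeff_closed by blast
    have "T.TG.glue \<kappa> g = \<kappa> m g"
      by (rule T.TG.glue_piece) (use closed additive piece in auto)
    thus ?case
      using a \<psi>_closed by (simp add: \<kappa>_monom)
  next
    case (add g h)
    thus ?case
      using frob_homsD(1,2)[OF hom] by (simp add: frob_homsD(2)[OF \<psi>])
  qed
  with hom show ?thesis using that by blast
qed

end

section \<open>Homogenization of elements and ideals\<close>

locale homogenized = graded_UP R \<pi> P for R (structure) and \<pi> and P (structure) +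
  fixes G
  assumes G_piece: "\<And>i. G i = piece i"
begin

abbreviation homogenize :: "'a \<Rightarrow> nat \<Rightarrow> 'a" ("_\<^sup>h" [1000] 999) where
  "f\<^sup>h \<equiv> homogenization R G f"

text \<open>Of the degree that enters \<open>f\<^sup>h\<close> only two properties matter: no component of \<open>f\<close> lies above it,
  and it is least with this property. For \<open>f = 0\<close> its value is unspecified and the second property
  may fail.\<close>
lemma homogenization_sum:
  assumes f: "f \<in> carrier R"
  obtains n where "supp f \<subseteq> {..n}" "\<And>m. supp f \<subseteq> {..m} \<Longrightarrow> f \<noteq> \<zero> \<Longrightarrow> n \<le> m"
    "f\<^sup>h = (\<Oplus>\<^bsub>P\<^esub>i\<in>{..n}. up_ring.monom P (\<pi> i f) (n - i))"
proof
  let ?n = "graded_degree R G f"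
  have hc: "homogeneous_components R G f = (\<lambda>i. \<pi> i f)"
    by (rule homogeneous_components_eq[OF f G_piece])
  have deg: "?n = Max (supp f)"
    by (simp add: graded_degree_def hc supp_def)
  show "f\<^sup>h = (\<Oplus>\<^bsub>P\<^esub>i\<in>{..?n}. up_ring.monom P (\<pi> i f) (?n - i))"
    unfolding homogenization_def hc P_def Let_def ..
  show "supp f \<subseteq> {..?n}"
    using finite_supp[OF f] by (auto simp: deg)
  show "?n \<le> m" if "supp f \<subseteq> {..m}" "f \<noteq> \<zero>" for m
  proof -
    have "supp f \<noteq> {}"
      using that(2) f comp_eqI[of f \<zero>] by (auto simp: supp_def)
    thus ?thesis
      using that(1) finite_supp[OF f] by (auto simp: deg)
  qed
qed

lemma homogenization_total_piece:
  assumes f: "f \<in> carrier R"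
  obtains n where "f\<^sup>h \<in> TG.piece n" "\<And>m. supp f \<subseteq> {..m} \<Longrightarrow> f \<noteq> \<zero> \<Longrightarrow> n \<le> m"
proof -
  obtain n where n: "supp f \<subseteq> {..n}" "\<And>m. supp f \<subseteq> {..m} \<Longrightarrow> f \<noteq> \<zero> \<Longrightarrow> n \<le> m"
    "f\<^sup>h = (\<Oplus>\<^bsub>P\<^esub>i\<in>{..n}. up_ring.monom P (\<pi> i f) (n - i))"
    by (rule homogenization_sum[OF f]) (rule that; assumption)
  have "up_ring.monom P (\<pi> i f) (n - i) \<in> TG.piece n" if "i \<le> n" for i
    using monom_total_piece[OF comp_in_piece[OF f], of i "n - i"] that by simp
  hence "f\<^sup>h \<in> TG.piece n"
    unfolding n(3) by (intro TG.piece_finsum) auto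
  thus ?thesis by (rule that) (rule n(2))
qed

lemma dehomogenization_homogenization:
  assumes f: "f \<in> carrier R"
  shows "\<delta> (f\<^sup>h) = f"
proof -
  interpret \<delta>: ring_hom_cring P R "dehomogenization R"
    by (rule dehomogenization_hom)
  obtain n where n: "supp f \<subseteq> {..n}"
    "f\<^sup>h = (\<Oplus>\<^bsub>P\<^esub>i\<in>{..n}. up_ring.monom P (\<pi> i f) (n - i))"
    by (rule homogenization_sum[OF f]) (rule that; assumption)
  have "\<delta> (f\<^sup>h) = (\<Oplus>i\<in>{..n}. \<pi> i f)"
    unfolding n(2) using comp_closed[OF f] by (subst \<delta>.hom_finsum) (auto simp: o_def)
  also have "\<dots> = f"
    by (rule sum_comp[OF f finite_atMost n(1)])
  finally show ?thesis .
qed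

lemma homogenization_closed:
  assumes f: "f \<in> carrier R"
  shows "f\<^sup>h \<in> carrier P"
proof -
  obtain n where n: "f\<^sup>h \<in> TG.piece n"
    by (rule homogenization_total_piece[OF f])
  show ?thesis by (rule TG.pieceD(1)[OF n])
qed

lemma dehomogenization_closed: "g \<in> carrier P \<Longrightarrow> \<delta> g \<in> carrier R"
  using ring_hom_closed[OF ring_hom_cring.homh[OF dehomogenization_hom]] .

text \<open>Both sides are homogeneous of the same degree and have the same dehomogenization. The degree of
  \<open>\<delta> g\<close> is at most that of \<open>g\<close>, and \<open>r\<close> is the difference; if \<open>\<delta> g = 0\<close> then both sides
  vanish.\<close>
lemma total_piece_eq_monom_mult_homogenization:
  assumes g: "g \<in> TG.piece n"
  obtains r where "g = up_ring.monom P \<one> r \<otimes>\<^bsub>P\<^esub> (\<delta> g)\<^sup>h"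
proof -
  interpret \<delta>: ring_hom_cring P R "dehomogenization R"
    by (rule dehomogenization_hom)
  have f: "\<delta> g \<in> carrier R"
    by (rule dehomogenization_closed[OF TG.pieceD(1)[OF g]])
  obtain d where d: "(\<delta> g)\<^sup>h \<in> TG.piece d"
    and d_le: "\<And>m. supp (\<delta> g) \<subseteq> {..m} \<Longrightarrow> \<delta> g \<noteq> \<zero> \<Longrightarrow> d \<le> m"
    by (rule homogenization_total_piece[OF f]) (rule that; assumption)
  have "\<exists>r. up_ring.monom P \<one> r \<otimes>\<^bsub>P\<^esub> (\<delta> g)\<^sup>h \<in> TG.piece n"
  proof (cases "\<delta> g = \<zero>")
    case True
    have "\<delta> ((\<delta> g)\<^sup>h) = \<delta> \<zero>\<^bsub>P\<^esub>"
      using dehomogenization_homogenization[OF f] True by (simp only: \<delta>.hom_zero)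
    hence "(\<delta> g)\<^sup>h = \<zero>\<^bsub>P\<^esub>"
      by (rule total_piece_eqI[OF d TG.zero_in_piece])
    hence "up_ring.monom P \<one> 0 \<otimes>\<^bsub>P\<^esub> (\<delta> g)\<^sup>h = \<zero>\<^bsub>P\<^esub>"
      by (simp only: P.r_null monom_closed R.one_closed)
    thus ?thesis
      using TG.zero_in_piece by metis
  next
    case False
    have "supp (\<delta> g) \<subseteq> {..n}"
      using comp_dehomogenization[OF g] by (auto simp: supp_def split: if_splits)
    hence eq: "0 + (n - d) + d = n"
      using d_le[of n] False by simp
    show ?thesis
      using TG.piece_mult[OF monom_total_piece[OF one_in_piece, of "n - d"] d] unfolding eq ..
  qed
  then obtain r where r: "up_ring.monom P \<one> r \<otimes>\<^bsub>P\<^esub> (\<delta> g)\<^sup>h \<in> TG.piece n" ..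
  have "\<delta> (up_ring.monom P \<one> r \<otimes>\<^bsub>P\<^esub> (\<delta> g)\<^sup>h) = \<delta> g"
    using \<delta>.hom_mult[OF monom_closed[OF R.one_closed] homogenization_closed[OF f], of r]
    by (simp add: dehomogenization_homogenization[OF f] f)
  hence "g = up_ring.monom P \<one> r \<otimes>\<^bsub>P\<^esub> (\<delta> g)\<^sup>h"
    by (intro total_piece_eqI[OF g r]) (rule sym)
  thus ?thesis by (rule that)
qed

lemma homogenization_ideal_eq: "homogenization_ideal R G J = genideal P (homogenization R G ` J)"
  unfolding homogenization_ideal_def P_def ..

context
  fixes J assumes J: "J \<subseteq> carrier R"
begin

lemma homogenization_image_subset: "homogenization R G ` J \<subseteq> carrier P"
  using J homogenization_closed by auto

lemma homogenization_ideal_is_ideal: "ideal (homogenization_ideal R G J) P"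
  unfolding homogenization_ideal_eq by (rule P.genideal_ideal[OF homogenization_image_subset])

lemma homogenization_ideal_graded: "TG.graded_subset (homogenization_ideal R G J)"
  unfolding homogenization_ideal_eq
proof (rule TG.genideal_graded)
  fix x assume "x \<in> homogenization R G ` J"
  then obtain f where f: "f \<in> carrier R" "x = f\<^sup>h"
    using J by blast
  obtain i where "f\<^sup>h \<in> TG.piece i"
    by (rule homogenization_total_piece[OF f(1)])
  thus "\<exists>i. x \<in> TG.piece i"
    unfolding f(2) ..
qed

lemma homogenization_in_homogenization_ideal: "f \<in> J \<Longrightarrow> f\<^sup>h \<in> homogenization_ideal R G J"
  unfolding homogenization_ideal_eq using P.genideal_self[OF homogenization_image_subset] by blast

lemma total_piece_in_homogenization_ideal:
  assumes g: "g \<in> TG.piece n" and "\<delta> g \<in> J"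
  shows "g \<in> homogenization_ideal R G J"
proof -
  obtain r where "g = up_ring.monom P \<one> r \<otimes>\<^bsub>P\<^esub> (\<delta> g)\<^sup>h"
    by (rule total_piece_eq_monom_mult_homogenization[OF g])
  moreover have "up_ring.monom P \<one> r \<otimes>\<^bsub>P\<^esub> (\<delta> g)\<^sup>h \<in> homogenization_ideal R G J"
    by (rule ideal.I_l_closed[OF homogenization_ideal_is_ideal homogenization_in_homogenization_ideal[OF assms(2)]]) simp
  ultimately show ?thesis by simp
qed

end

lemma dehomogenization_homogenization_ideal:
  assumes J: "ideal J R" and g: "g \<in> homogenization_ideal R G J"
  shows "\<delta> g \<in> J"
proof -
  interpret J: ideal J R by fact
  have sub: "J \<subseteq> carrier R" by (rule J.a_subset)
  interpret \<delta>: ring_hom_cring P R "dehomogenization R"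
    by (rule dehomogenization_hom)
  have "ideal {r \<in> carrier P. \<delta> r \<in> J} P"
    by (rule ring_hom_ring.ideal_vimage[OF _ J])
       (rule ring_hom_ringI2[OF P.ring_axioms R.ring_axioms \<delta>.homh])
  moreover have "homogenization R G ` J \<subseteq> {r \<in> carrier P. \<delta> r \<in> J}"
    using sub homogenization_closed dehomogenization_homogenization by auto
  ultimately have "homogenization_ideal R G J \<subseteq> {r \<in> carrier P. \<delta> r \<in> J}"
    unfolding homogenization_ideal_eq by (rule P.genideal_minimal)
  thus ?thesis using g by blast
qed

section \<open>Cartier cores and homogenization\<close>

text \<open>The ideals in the first equation are both homogeneous, so they are compared in each total degree,
  where a form \<open>g\<close> lies in the left-hand side if and only if \<open>\<delta> g\<close> lies in the core of \<open>J\<close>. The second equation then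
  comes from \<open>\<delta> (f\<^sup>h) = f\<close>.\<close>
theorem cartier_core_homogenization:
  assumes p: "Factorial_Ring.prime p" and char: "[p] \<cdot>\<^bsub>R\<^esub> \<one> = \<zero>" and J: "ideal J R"
  shows "homogenization_ideal R G (cartier_core p R J) = cartier_core p P (homogenization_ideal R G J)"
    and "cartier_core p R J = \<delta> ` cartier_core p P (homogenization_ideal R G J)"
proof -
  have sub: "J \<subseteq> carrier R" by (rule additive_subgroup.a_subset[OF ideal.axioms(1)[OF J]])
  have p0: "0 < p" using p by (simp add: prime_gt_0_nat)
  have const: "ring_hom_cring R P (\<lambda>a. up_ring.monom P a 0)"
    by unfold_locales (rule const_ring_hom)
  have charP: "[p] \<cdot>\<^bsub>P\<^esub> \<one>\<^bsub>P\<^esub> = \<zero>\<^bsub>P\<^esub>"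
    by (rule ring_hom_cring.char_eq_zero_image[OF const char])
  note frobR = R.prime_char_pow_pow_add[OF p char]
  note frobP = P.prime_char_pow_pow_add[OF p charP]
  let ?C = "cartier_core p R J" and ?D = "cartier_core p P (homogenization_ideal R G J)"
  have C_sub: "?C \<subseteq> carrier R"
    by (auto simp: cartier_core_alt)
  have D_ideal: "ideal ?D P"
    by (rule cartier_core_ideal[OF P.is_cring homogenization_ideal_is_ideal[OF sub]])
  have D_graded: "TG.graded_subset ?D"
    by (rule TG.cartier_core_graded[OF homogenization_ideal_is_ideal[OF sub] homogenization_ideal_graded[OF sub] p0 frobP])
  have D_to_C: "\<delta> g \<in> ?C" if g: "g \<in> ?D" for g
  proof -
    have g': "g \<in> carrier P" using g by (simp add: cartier_core_alt)
    have "\<psi> (\<delta> g) \<in> J" if \<psi>: "\<psi> \<in> frob_homs (p ^ e) R" and e: "e > 0" for e \<psi>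
    proof -
      have q: "0 < p ^ e" using p0 by simp
      obtain \<Phi> where \<Phi>: "\<Phi> \<in> frob_homs (p ^ e) P"
        "\<And>g. g \<in> carrier P \<Longrightarrow> \<delta> (\<Phi> g) = \<psi> (\<delta> g)"
        by (rule extend_frob_hom[OF \<psi> q frobP]; (assumption | (rule that; assumption)))
      have "\<Phi> g \<in> homogenization_ideal R G J"
        using g \<Phi>(1) e by (simp add: cartier_core_alt)
      thus ?thesis
        using dehomogenization_homogenization_ideal[OF J, of "\<Phi> g"] \<Phi>(2)[OF g'] by simp
    qed
    thus ?thesis
      using dehomogenization_closed[OF g'] by (simp add: cartier_core_alt)
  qed
  have C_to_D: "f\<^sup>h \<in> ?D" if f: "f \<in> ?C" for f
  proof -
    have f': "f \<in> carrier R" using f C_sub by blast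
    note fh = homogenization_closed[OF f']
    obtain n where n: "f\<^sup>h \<in> TG.piece n"
      by (rule homogenization_total_piece[OF f'])
    (* Membership in the graded ideal is tested on each component m; truncation makes that
       component the full value, and only a homogeneous value can be tested after delta. *)
    have "\<phi> (f\<^sup>h) \<in> homogenization_ideal R G J" if \<phi>: "\<phi> \<in> frob_homs (p ^ e) P" and e: "e > 0" for e \<phi>
    proof (rule TG.graded_subset_memI[OF homogenization_ideal_is_ideal[OF sub]])
      show "\<phi> (f\<^sup>h) \<in> carrier P"
        by (rule frob_homsD(1)[OF \<phi> fh])
      fix m
      have q: "0 < p ^ e" using p0 by simp
      obtain \<phi>' where \<phi>': "\<phi>' \<in> frob_homs (p ^ e) P"
        "\<And>x. x \<in> TG.piece n \<Longrightarrow> \<phi>' x = up_comp R \<pi> m (\<phi> x)"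
        by (rule TG.truncate_frob_hom[OF \<phi> q frobP, of n m]; (assumption | (rule that; assumption)))
      obtain \<psi> where \<psi>: "\<psi> \<in> frob_homs (p ^ e) R"
        "\<And>a. a \<in> TG.piece n \<Longrightarrow> \<psi> (\<delta> a) = \<delta> (\<phi>' a)"
        by (rule descend_frob_hom[OF \<phi>'(1) q frobR, of n]; (assumption | (rule that; assumption)))
      have "\<psi> f \<in> J"
        using f \<psi>(1) e by (simp add: cartier_core_alt)
      hence "\<delta> (up_comp R \<pi> m (\<phi> (f\<^sup>h))) \<in> J"
        using \<psi>(2)[OF n] \<phi>'(2)[OF n] dehomogenization_homogenization[OF f'] by simp
      thus "up_comp R \<pi> m (\<phi> (f\<^sup>h)) \<in> homogenization_ideal R G J"
        by (rule total_piece_in_homogenization_ideal[OF sub TG.comp_in_piece[OF frob_homsD(1)[OF \<phi> fh]]])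
    qed
    thus ?thesis
      using fh by (simp add: cartier_core_alt)
  qed
  show "homogenization_ideal R G ?C = ?D"
  proof
    show "homogenization_ideal R G ?C \<subseteq> ?D"
      unfolding homogenization_ideal_eq[of ?C] using C_to_D by (intro P.genideal_minimal D_ideal) auto
    show "?D \<subseteq> homogenization_ideal R G ?C"
    proof
      fix g assume g: "g \<in> ?D"
      hence g': "g \<in> carrier P" by (simp add: cartier_core_alt)
      show "g \<in> homogenization_ideal R G ?C"
      proof (rule TG.graded_subset_memI[OF homogenization_ideal_is_ideal[OF C_sub] g'])
        fix n
        have "\<delta> (up_comp R \<pi> n g) \<in> ?C"
          using g D_graded D_to_C by (simp add: TG.graded_subset_def)
        thus "up_comp R \<pi> n g \<in> homogenization_ideal R G ?C"
          by (rule total_piece_in_homogenization_ideal[OF C_sub TG.comp_in_piece[OF g']])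
      qed
    qed
  qed
  show "?C = \<delta> ` ?D"
  proof
    show "?C \<subseteq> \<delta> ` ?D"
    proof
      fix f assume f: "f \<in> ?C"
      hence "f = \<delta> (f\<^sup>h)"
        using C_sub dehomogenization_homogenization by auto
      thus "f \<in> \<delta> ` ?D"
        using C_to_D[OF f] by blast
    qed
    show "\<delta> ` ?D \<subseteq> ?C"
      using D_to_C by blast
  qed
qed

end

section \<open>Quotients by homogeneous ideals\<close>

context graded_cring
begin

text \<open>The union is over the cosets of the components of all representatives; for a homogeneous ideal they agree.\<close>
definition quotient_comp :: "'a set \<Rightarrow> nat \<Rightarrow> 'a set \<Rightarrow> 'a set" where
  "quotient_comp I i A = (\<Union>x\<in>A. I +> \<pi> i x)"

context
  fixes I assumes I: "ideal I R" and I_graded: "graded_subset I"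
begin

interpretation I: ideal I R by (rule I)

interpretation proj: ring_hom_cring R "R Quot I" "\<lambda>x. I +> x"
  by (rule I.rcos_ring_hom_cring[OF is_cring])

lemma coset_eq_iff:
  assumes "x \<in> carrier R" "y \<in> carrier R"
  shows "I +> x = I +> y \<longleftrightarrow> x \<ominus> y \<in> I"
  using quotient_eq_iff_same_a_r_cos[OF I assms] by blast

lemma carrier_quotient: "carrier (R Quot I) = (\<lambda>x. I +> x) ` carrier R"
  unfolding FactRing_def A_RCOSETS_def' partial_object.simps by (rule UNION_singleton_eq_range)

lemma comp_diff:
  assumes "x \<in> carrier R" "y \<in> carrier R"
  shows "\<pi> i (x \<ominus> y) = \<pi> i x \<ominus> \<pi> i y"
proof -
  have "\<pi> i (x \<ominus> y) \<oplus> \<pi> i y = \<pi> i x"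
    using assms by (simp add: a_minus_def a_assoc l_neg flip: comp_add)
  thus ?thesis
    using assms by (metis add.inv_solve_right comp_closed minus_closed a_minus_def)
qed

lemma quotient_comp_coset:
  assumes x: "x \<in> carrier R"
  shows "quotient_comp I i (I +> x) = I +> \<pi> i x"
proof -
  have "I +> \<pi> i y = I +> \<pi> i x" if y: "y \<in> I +> x" for y
  proof -
    have y': "y \<in> carrier R"
      by (rule I.a_elemrcos_carrier[OF x y])
    have "I +> y = I +> x"
      by (rule I.a_repr_independence'[OF y x, symmetric])
    hence "y \<ominus> x \<in> I"
      unfolding coset_eq_iff[OF y' x] .
    hence "\<pi> i y \<ominus> \<pi> i x \<in> I"
      using I_graded unfolding graded_subset_def comp_diff[OF y' x, symmetric] by blast
    thus ?thesis
      unfolding coset_eq_iff[OF comp_closed[OF y'] comp_closed[OF x]] .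
  qed
  moreover have "x \<in> I +> x"
    by (rule I.a_rcos_self[OF x])
  ultimately show ?thesis
    unfolding quotient_comp_def by blast
qed

lemma quotientE:
  assumes "A \<in> carrier (R Quot I)"
  obtains x where "x \<in> carrier R" "A = I +> x"
  using assms unfolding carrier_quotient by (rule imageE) (rule that)

lemma quotient_graded_cring: "graded_cring (R Quot I) (quotient_comp I)"
proof (intro graded_cring.intro graded_cring_axioms.intro)
  show "cring (R Quot I)"
    by (rule I.quotient_is_cring[OF is_cring])
next
  fix A i assume "A \<in> carrier (R Quot I)"
  then obtain x where x: "x \<in> carrier R" "A = I +> x"
    by (rule quotientE)
  show "quotient_comp I i A \<in> carrier (R Quot I)"
    unfolding x(2) quotient_comp_coset[OF x(1)] by (rule proj.hom_closed[OF comp_closed[OF x(1)]])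
  fix j
  show "quotient_comp I j (quotient_comp I i A) =
      (if j = i then quotient_comp I i A else \<zero>\<^bsub>R Quot I\<^esub>)"
    unfolding x(2) quotient_comp_coset[OF x(1)] quotient_comp_coset[OF comp_closed[OF x(1)]]
      comp_comp[OF x(1)]
    using proj.hom_zero by (cases "j = i") simp_all
next
  fix A B i j assume "A \<in> carrier (R Quot I)" "B \<in> carrier (R Quot I)"
  then obtain x y where x: "x \<in> carrier R" "A = I +> x" and y: "y \<in> carrier R" "B = I +> y"
    by (metis quotientE)
  show "quotient_comp I i (A \<oplus>\<^bsub>R Quot I\<^esub> B) =
      quotient_comp I i A \<oplus>\<^bsub>R Quot I\<^esub> quotient_comp I i B"
    unfolding x(2) y(2) proj.hom_add[OF x(1) y(1), symmetric] quotient_comp_coset[OF a_closed[OF x(1) y(1)]]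
      comp_add[OF x(1) y(1)] quotient_comp_coset[OF x(1)] quotient_comp_coset[OF y(1)]
    by (rule proj.hom_add[OF comp_closed[OF x(1)] comp_closed[OF y(1)]])
  have xy: "\<pi> i x \<otimes> \<pi> j y \<in> carrier R"
    using x y by simp
  show "quotient_comp I (i + j) (quotient_comp I i A \<otimes>\<^bsub>R Quot I\<^esub> quotient_comp I j B) =
      quotient_comp I i A \<otimes>\<^bsub>R Quot I\<^esub> quotient_comp I j B"
    unfolding x(2) y(2) quotient_comp_coset[OF x(1)] quotient_comp_coset[OF y(1)]
      proj.hom_mult[OF comp_closed[OF x(1)] comp_closed[OF y(1)], symmetric]
      quotient_comp_coset[OF xy] comp_mult[OF x(1) y(1)] ..
  assume eq: "\<And>i. quotient_comp I i A = quotient_comp I i B"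
  have "\<pi> i (x \<ominus> y) \<in> I" for i
    using eq[of i]
    unfolding x(2) y(2) quotient_comp_coset[OF x(1)] quotient_comp_coset[OF y(1)]
      comp_diff[OF x(1) y(1)] coset_eq_iff[OF comp_closed[OF x(1)] comp_closed[OF y(1)]] .
  hence "x \<ominus> y \<in> I"
    by (rule graded_subset_memI[OF I minus_closed[OF x(1) y(1)]])
  thus "A = B"
    unfolding x(2) y(2) coset_eq_iff[OF x(1) y(1)] .
next
  fix A assume "A \<in> carrier (R Quot I)"
  then obtain x where x: "x \<in> carrier R" "A = I +> x"
    by (rule quotientE)
  have "quotient_comp I i A = \<zero>\<^bsub>R Quot I\<^esub>" if "\<pi> i x = \<zero>" for i
    unfolding x(2) quotient_comp_coset[OF x(1)] that by (rule proj.hom_zero)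
  hence "{i. quotient_comp I i A \<noteq> \<zero>\<^bsub>R Quot I\<^esub>} \<subseteq> {i. \<pi> i x \<noteq> \<zero>}"
    by auto
  thus "finite {i. quotient_comp I i A \<noteq> \<zero>\<^bsub>R Quot I\<^esub>}"
    by (rule finite_subset) (rule comp_finite[OF x(1)])
qed

lemma quotient_piece:
  "graded_cring.piece (R Quot I) (quotient_comp I) i = (\<lambda>x. I +> x) ` piece i"
proof -
  interpret Q: graded_cring "R Quot I" "quotient_comp I"
    by (rule quotient_graded_cring)
  show ?thesis
  proof (intro equalityI subsetI)
    fix A assume A: "A \<in> Q.piece i"
    obtain x where x: "x \<in> carrier R" "A = I +> x"
      by (rule quotientE[OF Q.pieceD(1)[OF A]])
    have "A = I +> \<pi> i x"
      using Q.pieceD(2)[OF A] unfolding x(2) quotient_comp_coset[OF x(1)] by (rule sym)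
    thus "A \<in> (\<lambda>x. I +> x) ` piece i"
      by (rule image_eqI) (rule comp_in_piece[OF x(1)])
  next
    fix A assume "A \<in> (\<lambda>x. I +> x) ` piece i"
    then obtain x where x: "A = I +> x" "x \<in> piece i"
      by (rule imageE)
    note x' = pieceD[OF x(2)]
    have "quotient_comp I i A = A"
      unfolding x(1) quotient_comp_coset[OF x'(1)] x'(2) ..
    moreover have "A \<in> carrier (R Quot I)"
      unfolding x(1) by (rule proj.hom_closed[OF x'(1)])
    ultimately show "A \<in> Q.piece i"
      by (simp add: Q.piece_def)
  qed
qed

end

end

section \<open>The standard grading of the polynomial ring\<close>

definition monomial_degree :: "(nat \<Rightarrow>\<^sub>0 nat) \<Rightarrow> nat" where
  "monomial_degree m = (\<Sum>v\<in>Poly_Mapping.keys m. Poly_Mapping.lookup m v)"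

lemma monomial_degree_add: "monomial_degree (a + b) = monomial_degree a + monomial_degree b"
  unfolding monomial_degree_def by (rule setsum_keys_plus_distrib) auto

definition mpoly_comp :: "nat \<Rightarrow> ((nat \<Rightarrow>\<^sub>0 nat) \<Rightarrow>\<^sub>0 'k::zero) \<Rightarrow> ((nat \<Rightarrow>\<^sub>0 nat) \<Rightarrow>\<^sub>0 'k)" where
  "mpoly_comp i f = Poly_Mapping.mapp (\<lambda>m c. c when monomial_degree m = i) f"

lemma lookup_mpoly_comp:
  "Poly_Mapping.lookup (mpoly_comp i f) m = (Poly_Mapping.lookup f m when monomial_degree m = i)"
  by (auto simp: mpoly_comp_def lookup_mapp when_def in_keys_iff)

lemma keys_mpoly_comp:
  "Poly_Mapping.keys (mpoly_comp i f) = {m \<in> Poly_Mapping.keys f. monomial_degree m = i}"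
  by (auto simp: in_keys_iff lookup_mpoly_comp)

lemma mpoly_comp_eq_self_iff:
  "mpoly_comp i f = f \<longleftrightarrow> (\<forall>m\<in>Poly_Mapping.keys f. monomial_degree m = i)"
  by (auto simp: poly_mapping_eq_iff fun_eq_iff lookup_mpoly_comp in_keys_iff when_def)

lemma mpoly_ring_simps:
  "carrier (mpoly_ring d :: ((nat \<Rightarrow>\<^sub>0 nat) \<Rightarrow>\<^sub>0 'k::field) ring) =
     {f. \<forall>m\<in>Poly_Mapping.keys f. Poly_Mapping.keys m \<subseteq> {1..d}}"
  "f \<otimes>\<^bsub>mpoly_ring d\<^esub> g = f * g" "f \<oplus>\<^bsub>mpoly_ring d\<^esub> g = f + g"
  "\<one>\<^bsub>mpoly_ring d\<^esub> = 1" "\<zero>\<^bsub>mpoly_ring d\<^esub> = 0"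
  by (simp_all add: mpoly_ring_def ring_of_type_algebra_def)

lemma mpoly_ring_cring: "cring (mpoly_ring d :: ((nat \<Rightarrow>\<^sub>0 nat) \<Rightarrow>\<^sub>0 'k::field) ring)"
proof -
  let ?A = "ring_of_type_algebra :: ((nat \<Rightarrow>\<^sub>0 nat) \<Rightarrow>\<^sub>0 'k) ring"
  let ?C = "{f :: (nat \<Rightarrow>\<^sub>0 nat) \<Rightarrow>\<^sub>0 'k. \<forall>m\<in>Poly_Mapping.keys f. Poly_Mapping.keys m \<subseteq> {1..d}}"
  interpret A: cring ?A ..
  have sub: "?C \<subseteq> carrier ?A"
    by (simp add: ring_of_type_algebra_def)
  have neg: "\<ominus>\<^bsub>?A\<^esub> f = - f" for f
    by (rule A.minus_equality) (auto simp: ring_of_type_algebra_def)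
  have "subring ?C ?A"
  proof (rule A.subringI[OF sub])
    fix f g assume fg: "f \<in> ?C" "g \<in> ?C"
    have "Poly_Mapping.keys m \<subseteq> {1..d}" if m: "m \<in> Poly_Mapping.keys (f * g)" for m
    proof -
      obtain a b where ab: "a \<in> Poly_Mapping.keys f" "b \<in> Poly_Mapping.keys g" "m = a + b"
        using subsetD[OF keys_mult m] by auto
      thus ?thesis
        using fg keys_add[of a b] by fastforce
    qed
    thus "f \<otimes>\<^bsub>?A\<^esub> g \<in> ?C"
      by (auto simp: ring_of_type_algebra_def)
    show "f \<oplus>\<^bsub>?A\<^esub> g \<in> ?C"
      using fg keys_add[of f g] by (auto simp: ring_of_type_algebra_def)
    show "\<ominus>\<^bsub>?A\<^esub> f \<in> ?C"
      using fg by (auto simp: neg in_keys_iff)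
  qed (auto simp: ring_of_type_algebra_def)
  hence "subcring ?C ?A"
    by (rule A.subcringI')
  thus ?thesis
    using A.subcring_iff[OF sub] by (simp add: mpoly_ring_def)
qed

lemma mpoly_ring_graded: "graded_cring (mpoly_ring d :: ((nat \<Rightarrow>\<^sub>0 nat) \<Rightarrow>\<^sub>0 'k::field) ring) mpoly_comp"
proof (intro graded_cring.intro graded_cring_axioms.intro mpoly_ring_cring)
  fix f g :: "(nat \<Rightarrow>\<^sub>0 nat) \<Rightarrow>\<^sub>0 'k" and i j
  let ?S = "mpoly_ring d :: ((nat \<Rightarrow>\<^sub>0 nat) \<Rightarrow>\<^sub>0 'k) ring"
  show "mpoly_comp i f \<in> carrier ?S" if "f \<in> carrier ?S"
    using that by (auto simp: mpoly_ring_simps keys_mpoly_comp)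
  show "mpoly_comp i (f \<oplus>\<^bsub>?S\<^esub> g) = mpoly_comp i f \<oplus>\<^bsub>?S\<^esub> mpoly_comp i g"
    by (simp add: mpoly_ring_simps poly_mapping_eq_iff fun_eq_iff lookup_mpoly_comp lookup_add
        when_add_distrib)
  show "mpoly_comp i (mpoly_comp j f) = (if i = j then mpoly_comp j f else \<zero>\<^bsub>?S\<^esub>)"
    by (auto simp: mpoly_ring_simps poly_mapping_eq_iff fun_eq_iff lookup_mpoly_comp when_def)
  show "mpoly_comp (i + j) (mpoly_comp i f \<otimes>\<^bsub>?S\<^esub> mpoly_comp j g) =
      mpoly_comp i f \<otimes>\<^bsub>?S\<^esub> mpoly_comp j g"
    unfolding mpoly_ring_simps mpoly_comp_eq_self_iff
    using keys_mult[of "mpoly_comp i f" "mpoly_comp j g"]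
    by (auto simp: keys_mpoly_comp monomial_degree_add)
  have "{i. mpoly_comp i f \<noteq> 0} \<subseteq> monomial_degree ` Poly_Mapping.keys f"
    by (auto simp: poly_mapping_eq_iff fun_eq_iff lookup_mpoly_comp when_def in_keys_iff)
  thus "finite {i. mpoly_comp i f \<noteq> \<zero>\<^bsub>?S\<^esub>}"
    unfolding mpoly_ring_simps by (rule finite_subset) simp
  show "f = g" if eq: "\<And>i. mpoly_comp i f = mpoly_comp i g"
  proof (rule poly_mapping_eqI)
    fix m
    show "Poly_Mapping.lookup f m = Poly_Mapping.lookup g m"
      using arg_cong[OF eq[of "monomial_degree m"], of "\<lambda>f. Poly_Mapping.lookup f m"]
      by (simp add: lookup_mpoly_comp)
  qed
qed

lemma standard_grading_eq_piece:
  "standard_grading d i = graded_cring.piece (mpoly_ring d :: ((nat \<Rightarrow>\<^sub>0 nat) \<Rightarrow>\<^sub>0 'k::field) ring) mpoly_comp i"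
  unfolding graded_cring.piece_def[OF mpoly_ring_graded] standard_grading_def mpoly_comp_eq_self_iff
  by (simp add: monomial_degree_def)

lemma mpoly_ring_char:
  assumes "CHAR('k::field) = p"
  shows "[p] \<cdot>\<^bsub>mpoly_ring d\<^esub> \<one>\<^bsub>mpoly_ring d\<^esub> =
    (\<zero>\<^bsub>mpoly_ring d\<^esub> :: (nat \<Rightarrow>\<^sub>0 nat) \<Rightarrow>\<^sub>0 'k::field)"
proof -
  let ?S = "mpoly_ring d :: ((nat \<Rightarrow>\<^sub>0 nat) \<Rightarrow>\<^sub>0 'k) ring"
  interpret cring ?S by (rule mpoly_ring_cring)
  have "[n] \<cdot>\<^bsub>?S\<^esub> \<one>\<^bsub>?S\<^esub> = of_nat n" for n :: nat
    by (induction n) (simp_all add: mpoly_ring_simps add.commute)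
  moreover have "of_nat p = (0 :: (nat \<Rightarrow>\<^sub>0 nat) \<Rightarrow>\<^sub>0 'k)"
    using assms by (intro poly_mapping_eqI) (auto simp: lookup_of_nat of_nat_eq_0_iff_char_dvd)
  ultimately show ?thesis
    by (simp add: mpoly_ring_simps)
qed

text \<open>The quotient grading on \<open>R\<close> puts it under the theorem for graded rings; \<open>p = 0\<close> in \<open>R\<close> is
  inherited from \<open>k\<close>.\<close>
theorem lemma4p10:
  fixes p d :: nat
    and S :: "((nat \<Rightarrow>\<^sub>0 nat) \<Rightarrow>\<^sub>0 'k::field) ring"
    and I :: "((nat \<Rightarrow>\<^sub>0 nat) \<Rightarrow>\<^sub>0 'k) set"
    and R :: "((nat \<Rightarrow>\<^sub>0 nat) \<Rightarrow>\<^sub>0 'k) set ring"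
    and G :: "nat \<Rightarrow> ((nat \<Rightarrow>\<^sub>0 nat) \<Rightarrow>\<^sub>0 'k) set set"
    and J :: "((nat \<Rightarrow>\<^sub>0 nat) \<Rightarrow>\<^sub>0 'k) set set"
  assumes "Factorial_Ring.prime p" and "CHAR('k) = p"
    and "F_finite p (ring_of_type_algebra :: 'k ring)"
    and "S = mpoly_ring d"
    and "homogeneous_ideal S (standard_grading d) I"
    and "R = S Quot I"
    and "G = quotient_grading S I (standard_grading d)"
    and "ideal J R"
  shows "homogenization_ideal R G (cartier_core p R J)
           = cartier_core p (UP R) (homogenization_ideal R G J)
       \<and> cartier_core p R J
           = dehomogenization R ` cartier_core p (UP R) (homogenization_ideal R G J)"
proof -
  interpret S: graded_cring S mpoly_comp
    unfolding assms(4) by (rule mpoly_ring_graded)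
  have piece: "standard_grading d i = S.piece i" for i
    unfolding assms(4) by (rule standard_grading_eq_piece)
  have I: "ideal I S" and I_gen: "I = Idl\<^bsub>S\<^esub> (I \<inter> (\<Union>i. S.piece i))"
    using assms(5) by (auto simp: homogeneous_ideal_def piece)
  have I_graded: "S.graded_subset I"
    by (subst I_gen) (rule S.genideal_graded, blast)
  interpret R: graded_cring R "S.quotient_comp I"
    unfolding assms(6) by (rule S.quotient_graded_cring[OF I I_graded])
  have char: "[p] \<cdot>\<^bsub>R\<^esub> \<one>\<^bsub>R\<^esub> = \<zero>\<^bsub>R\<^esub>"
  proof -
    have "ring_hom_cring S R (\<lambda>x. I +>\<^bsub>S\<^esub> x)"
      unfolding assms(6) by (rule ideal.rcos_ring_hom_cring[OF I S.is_cring])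
    thus ?thesis
      using mpoly_ring_char[OF assms(2), of d] unfolding assms(4)
      by (rule ring_hom_cring.char_eq_zero_image)
  qed
  interpret homogenized R "S.quotient_comp I" "UP R" G
  proof unfold_locales
    fix i
    show "G i = R.piece i"
      unfolding assms(6,7) quotient_grading_def piece
      by (rule S.quotient_piece[OF I I_graded, symmetric])
  qed
  show ?thesis
    by (intro conjI cartier_core_homogenization[OF assms(1) char assms(8)])
qed

end
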